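(* Let $G$ be a finitely generated solvable group. Then $G$ has the property ERF if and only if $G$ is polycyclic.
   Context: A group $G$ has the property ERF (extended residually finite) if every subgroup of $G$ is closed in the profinite topology of $G$; equivalently, for every subgroup $S$ of $G$ and every element $x \in G - S$ there is a finite index subgroup of $G$ which contains $S$ and does not contain $x$. *)

theory Defs
  imports
    "HOL-Algebra.Solvable_Groups"
    "HOL-Algebra.Elementary_Groups"
    "HOL-Algebra.Zassenhaus"
    "HOL-Analysis.Abstract_Topology"
begin

definition finitely_generated_group :: "('a, 'b) monoid_scheme \<Rightarrow> bool"
  where "finitely_generated_group G \<longleftrightarrow>
    (\<exists>A. finite A \<and> A \<subseteq> carrier G \<and> generate G A = carrier G)"

definition finite_index :: "'a set \<Rightarrow> ('a, 'b) monoid_scheme \<Rightarrow> bool"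
  where "finite_index H G \<longleftrightarrow> subgroup H G \<and> finite (rcosets\<^bsub>G\<^esub> H)"

text \<open>The cosets of the normal subgroups of finite index form a base of the profinite topology;
  \<open>carrier G\<close> is one of them, so it is the underlying space.\<close>

definition profinite_topology :: "('a, 'b) monoid_scheme \<Rightarrow> 'a topology"
  where "profinite_topology G =
    topology_generated_by {N #>\<^bsub>G\<^esub> x | N x. N \<lhd> G \<and> finite_index N G \<and> x \<in> carrier G}"

definition ERF :: "('a, 'b) monoid_scheme \<Rightarrow> bool"
  where "ERF G \<longleftrightarrow> (\<forall>S. subgroup S G \<longrightarrow> closedin (profinite_topology G) S)"

text \<open>A polycyclic group has a finite series from the trivial subgroup up to \<open>carrier G\<close>, each term
  normal in the next one with cyclic factor. The series is encoded in the same way as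
  \<^const>\<open>solvable_seq\<close> encodes a series with abelian factors.\<close>

inductive polycyclic_seq :: "('a, 'b) monoid_scheme \<Rightarrow> 'a set \<Rightarrow> bool"
  for G where
    unity: "polycyclic_seq G {\<one>\<^bsub>G\<^esub>}"
  | extension: "\<lbrakk> polycyclic_seq G K; K \<lhd> (G \<lparr> carrier := H \<rparr>); subgroup H G;
                  cyclic_group ((G \<lparr> carrier := H \<rparr>) Mod K) \<rbrakk> \<Longrightarrow> polycyclic_seq G H"

definition polycyclic :: "('a, 'b) monoid_scheme \<Rightarrow> bool"
  where "polycyclic G \<longleftrightarrow> polycyclic_seq G (carrier G)"

context group
begin

lemma finite_index_mono:
  assumes N: "finite_index N G" and H: "subgroup H G" and NH: "N \<subseteq> H"
  shows "finite_index H G"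
proof -
  have Nc: "N \<subseteq> carrier G" and Hc: "H \<subseteq> carrier G"
    using N H by (auto simp: finite_index_def dest: subgroup.subset)
  have HN: "H <#> N = H"
  proof
    show "H <#> N \<subseteq> H" using H NH by (auto simp: set_mult_def intro: subgroup.m_closed)
    have "\<one> \<in> N" using N by (auto simp: finite_index_def dest: subgroup.one_closed)
    then show "H \<subseteq> H <#> N" using Hc by (force simp: set_mult_def)
  qed
  have "rcosets H \<subseteq> (\<lambda>C. H <#> C) ` (rcosets N)"
  proof
    fix C assume "C \<in> rcosets H"
    then obtain g where g: "g \<in> carrier G" "C = H #> g" by (auto simp: RCOSETS_def)
    have "C = H <#> (N #> g)" using setmult_rcos_assoc[OF Hc Nc g(1)] HN g by simp
    then show "C \<in> (\<lambda>C. H <#> C) ` (rcosets N)" using g by (auto simp: RCOSETS_def)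
  qed
  moreover have "finite (rcosets N)" using N by (simp add: finite_index_def)
  ultimately have "finite (rcosets H)" by (rule finite_surj[rotated])
  then show ?thesis using H by (simp add: finite_index_def)
qed

lemma finite_index_Int:
  assumes "finite_index M G" "finite_index N G"
  shows "finite_index (M \<inter> N) G"
proof -
  have c: "M \<subseteq> carrier G" "N \<subseteq> carrier G"
    using assms by (auto simp: finite_index_def dest: subgroup.subset)
  have "(M \<inter> N) #> g = (M #> g) \<inter> (N #> g)" if "g \<in> carrier G" for g
  proof
    show "(M \<inter> N) #> g \<subseteq> (M #> g) \<inter> (N #> g)" by (auto simp: r_coset_def)
    show "(M #> g) \<inter> (N #> g) \<subseteq> (M \<inter> N) #> g"
    proof
      fix y assume "y \<in> (M #> g) \<inter> (N #> g)"
      then obtain m n where mn: "m \<in> M" "n \<in> N" "y = m \<otimes> g" "y = n \<otimes> g"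
        by (auto simp: r_coset_def)
      have "m = n" using mn c that right_cancel[of g m n] by auto
      then show "y \<in> (M \<inter> N) #> g" using mn by (auto simp: r_coset_def)
    qed
  qed
  then have "rcosets (M \<inter> N) \<subseteq> (\<lambda>(A, B). A \<inter> B) ` ((rcosets M) \<times> (rcosets N))"
    by (force simp: RCOSETS_def)
  moreover have "finite ((rcosets M) \<times> (rcosets N))"
    using assms by (simp add: finite_index_def)
  ultimately have "finite (rcosets (M \<inter> N))" by (rule finite_surj[rotated])
  then show ?thesis using assms by (simp add: finite_index_def subgroups_Inter_pair)
qed

lemma finite_index_core:
  assumes H: "finite_index H G"
  shows "\<exists>N. N \<lhd> G \<and> finite_index N G \<and> N \<subseteq> H"
proof -
  have sH: "subgroup H G" and Hc: "H \<subseteq> carrier G" and fin: "finite (rcosets H)"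
    using H by (auto simp: finite_index_def dest: subgroup.subset)
  define N where "N = {g \<in> carrier G. \<forall>x \<in> carrier G. (H #> x) #> g = H #> x}"
  have eq: "(H #> x) #> g = H #> (x \<otimes> g)" if "x \<in> carrier G" "g \<in> carrier G" for x g
    using coset_mult_assoc Hc that by blast
  have mem: "g \<in> N \<longleftrightarrow> g \<in> carrier G \<and> (\<forall>x \<in> carrier G. H #> (x \<otimes> g) = H #> x)" for g
    by (auto simp: N_def eq)
  have sN: "subgroup N G"
  proof (rule subgroupI)
    show "N \<subseteq> carrier G" by (auto simp: N_def)
    show "N \<noteq> {}" using mem[of \<one>] by auto
  next
    fix a assume a: "a \<in> N"
    then have ac: "a \<in> carrier G" by (simp add: mem)
    have "H #> (x \<otimes> inv a) = H #> x" if x: "x \<in> carrier G" for x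
    proof -
      have "H #> ((x \<otimes> inv a) \<otimes> a) = H #> (x \<otimes> inv a)" using a x ac mem by blast
      then show ?thesis using x ac by (simp add: m_assoc)
    qed
    then show "inv a \<in> N" using ac by (simp add: mem)
  next
    fix a b assume "a \<in> N" "b \<in> N"
    then show "a \<otimes> b \<in> N" by (simp add: mem m_assoc[symmetric])
  qed
  have nN: "N \<lhd> G"
  proof (rule normal_invI[OF sN])
    fix y h assume y: "y \<in> carrier G" and h: "h \<in> N"
    then have hc: "h \<in> carrier G" by (simp add: mem)
    have "H #> (x \<otimes> (y \<otimes> h \<otimes> inv y)) = H #> x" if x: "x \<in> carrier G" for x
    proof -
      have "H #> (x \<otimes> (y \<otimes> h \<otimes> inv y)) = (H #> ((x \<otimes> y) \<otimes> h)) #> inv y"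
        using x y hc by (simp add: eq m_assoc)
      also have "\<dots> = (H #> (x \<otimes> y)) #> inv y" using x y h mem by simp
      also have "\<dots> = H #> x" using x y by (simp add: eq m_assoc)
      finally show ?thesis .
    qed
    then show "y \<otimes> h \<otimes> inv y \<in> N" using y hc by (simp add: mem)
  qed
  have NH: "N \<subseteq> H"
  proof
    fix g assume g: "g \<in> N"
    then have gc: "g \<in> carrier G" by (simp add: mem)
    have "H #> (\<one> \<otimes> g) = H #> \<one>" using g mem by blast
    then have "H #> g = H" using gc Hc by simp
    then show "g \<in> H" using coset_join1[OF _ gc sH] by simp
  qed
  define \<phi> where "\<phi> g = restrict (\<lambda>C. C #> g) (rcosets H)" for g
  have "\<phi> ` carrier G \<subseteq> (rcosets H) \<rightarrow>\<^sub>E (rcosets H)"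
  proof
    fix p assume "p \<in> \<phi> ` carrier G"
    then obtain g where g: "g \<in> carrier G" "p = \<phi> g" by blast
    have "C #> g \<in> rcosets H" if C: "C \<in> rcosets H" for C
    proof -
      obtain x where x: "x \<in> carrier G" "C = H #> x" using C by (auto simp: RCOSETS_def)
      then show ?thesis using g rcosetsI[OF Hc, of "x \<otimes> g"] by (simp add: eq)
    qed
    then show "p \<in> (rcosets H) \<rightarrow>\<^sub>E (rcosets H)" using g by (simp add: \<phi>_def)
  qed
  then have fphi: "finite (\<phi> ` carrier G)"
    by (rule finite_subset) (simp add: fin finite_PiE)
  have same: "N #> g = N #> h" if g: "g \<in> carrier G" and h: "h \<in> carrier G" and p: "\<phi> g = \<phi> h" for g h
  proof -
    have *: "H #> (x \<otimes> g) = H #> (x \<otimes> h)" if x: "x \<in> carrier G" for x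
    proof -
      have "H #> x \<in> rcosets H" using x by (auto simp: RCOSETS_def)
      then have "(H #> x) #> g = (H #> x) #> h" using fun_cong[OF p, of "H #> x"] by (simp add: \<phi>_def)
      then show ?thesis using x g h by (simp add: eq)
    qed
    have "H #> (x \<otimes> (g \<otimes> inv h)) = H #> x" if x: "x \<in> carrier G" for x
    proof -
      have "H #> (x \<otimes> (g \<otimes> inv h)) = (H #> (x \<otimes> g)) #> inv h"
        using x g h by (simp add: eq m_assoc)
      also have "\<dots> = (H #> (x \<otimes> h)) #> inv h" using * x by simp
      also have "\<dots> = H #> x" using x h by (simp add: eq m_assoc)
      finally show ?thesis .
    qed
    then have "g \<otimes> inv h \<in> N" using g h by (simp add: mem)
    then have "N #> (g \<otimes> inv h) = N" using g h sN by (intro coset_join2) auto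
    then show ?thesis using g h sN by (intro coset_mult_inv1) (auto dest: subgroup.subset)
  qed
  have "rcosets N \<subseteq> (\<lambda>p. N #> (SOME g. g \<in> carrier G \<and> \<phi> g = p)) ` (\<phi> ` carrier G)"
  proof
    fix C assume "C \<in> rcosets N"
    then obtain g where g: "g \<in> carrier G" "C = N #> g" by (auto simp: RCOSETS_def)
    let ?h = "SOME h. h \<in> carrier G \<and> \<phi> h = \<phi> g"
    have "?h \<in> carrier G \<and> \<phi> ?h = \<phi> g" by (rule someI[of _ g]) (use g in auto)
    then have "C = N #> ?h" using same g by metis
    then show "C \<in> (\<lambda>p. N #> (SOME g. g \<in> carrier G \<and> \<phi> g = p)) ` (\<phi> ` carrier G)"
      using g by blast
  qed
  then have "finite (rcosets N)" using fphi by (rule finite_surj[rotated])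
  then show ?thesis using sN nN NH by (auto simp: finite_index_def)
qed

lemma topspace_profinite_topology: "topspace (profinite_topology G) = carrier G"
proof -
  have "carrier G \<lhd> G" by (simp add: normal_invI subgroup_self)
  moreover have "finite_index (carrier G) G"
  proof -
    have "rcosets (carrier G) \<subseteq> {carrier G}"
      using coset_join2[OF _ subgroup_self] by (auto simp: RCOSETS_def)
    then have "finite (rcosets (carrier G))" by (rule finite_subset) simp
    then show ?thesis by (simp add: finite_index_def subgroup_self)
  qed
  moreover have "carrier G = carrier G #> \<one>" by simp
  ultimately have "carrier G \<in> {N #> x | N x. N \<lhd> G \<and> finite_index N G \<and> x \<in> carrier G}"
    using one_closed by blast
  moreover have "N #> x \<subseteq> carrier G" if "N \<lhd> G" "x \<in> carrier G" for N x
    using r_coset_subset_G[OF subgroup.subset[OF normal_imp_subgroup[OF that(1)]] that(2)] .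
  ultimately show ?thesis unfolding profinite_topology_def topology_generated_by_topspace
    by blast
qed

lemma openin_profinite_topology:
  "openin (profinite_topology G) U \<longleftrightarrow>
    U \<subseteq> carrier G \<and> (\<forall>x\<in>U. \<exists>N. N \<lhd> G \<and> finite_index N G \<and> N #> x \<subseteq> U)"
proof (intro iffI conjI)
  let ?B = "{N #> x | N x. N \<lhd> G \<and> finite_index N G \<and> x \<in> carrier G}"
  assume op: "openin (profinite_topology G) U"
  then show "U \<subseteq> carrier G" using openin_subset topspace_profinite_topology by metis
  have "generate_topology_on ?B U" using op
    by (simp add: profinite_topology_def openin_topology_generated_by_iff)
  then show "\<forall>x\<in>U. \<exists>N. N \<lhd> G \<and> finite_index N G \<and> N #> x \<subseteq> U"
  proof (induction rule: generate_topology_on.induct)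
    case Empty
    show ?case by simp
  next
    case (Int a b)
    show ?case
    proof
      fix x assume "x \<in> a \<inter> b"
      then obtain M N where *: "M \<lhd> G" "finite_index M G" "M #> x \<subseteq> a"
        "N \<lhd> G" "finite_index N G" "N #> x \<subseteq> b" using Int by blast
      then have "(M \<inter> N) #> x \<subseteq> a \<inter> b" by (auto simp: r_coset_def)
      then show "\<exists>N. N \<lhd> G \<and> finite_index N G \<and> N #> x \<subseteq> a \<inter> b"
        using finite_index_Int[OF *(2,5)] normal_subgroup_intersect[OF *(1,4)] by blast
    qed
  next
    case (Basis s)
    then obtain N y where *: "s = N #> y" "N \<lhd> G" "finite_index N G" "y \<in> carrier G" by blast
    have "N #> x = N #> y" if "x \<in> N #> y" for x
      using repr_independence[OF that *(4) normal_imp_subgroup[OF *(2)]] by simp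
    then show ?case using * by blast
  next
    case (UN K)
    show ?case
    proof
      fix x assume "x \<in> \<Union>K"
      then obtain k where k: "k \<in> K" "x \<in> k" by blast
      then obtain N where "N \<lhd> G" "finite_index N G" "N #> x \<subseteq> k" using UN.IH by blast
      then show "\<exists>N. N \<lhd> G \<and> finite_index N G \<and> N #> x \<subseteq> \<Union>K" using k by blast
    qed
  qed
next
  let ?B = "{N #> x | N x. N \<lhd> G \<and> finite_index N G \<and> x \<in> carrier G}"
  assume *: "U \<subseteq> carrier G \<and> (\<forall>x\<in>U. \<exists>N. N \<lhd> G \<and> finite_index N G \<and> N #> x \<subseteq> U)"
  have "U = \<Union>{C \<in> ?B. C \<subseteq> U}"
  proof
    show "U \<subseteq> \<Union>{C \<in> ?B. C \<subseteq> U}"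
    proof
      fix x assume x: "x \<in> U"
      then obtain N where N: "N \<lhd> G" "finite_index N G" "N #> x \<subseteq> U" using * by blast
      have xc: "x \<in> carrier G" using x * by blast
      have "x \<in> N #> x" using rcos_self[OF xc normal_imp_subgroup[OF N(1)]] .
      then show "x \<in> \<Union>{C \<in> ?B. C \<subseteq> U}" using N xc by blast
    qed
  qed auto
  moreover have "generate_topology_on ?B (\<Union>{C \<in> ?B. C \<subseteq> U})"
    by (rule generate_topology_on.UN) (blast intro: generate_topology_on.Basis)
  ultimately show "openin (profinite_topology G) U"
    by (simp add: profinite_topology_def openin_topology_generated_by_iff)
qed

text \<open>ERF is separation of subgroups from outside points by subgroups of finite index.\<close>

lemma ERF_iff:
  "ERF G \<longleftrightarrow> (\<forall>S. subgroup S G \<longrightarrow>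
    (\<forall>x \<in> carrier G - S. \<exists>H. finite_index H G \<and> S \<subseteq> H \<and> x \<notin> H))"
proof -
  have "closedin (profinite_topology G) S \<longleftrightarrow>
    (\<forall>x \<in> carrier G - S. \<exists>H. finite_index H G \<and> S \<subseteq> H \<and> x \<notin> H)"
    if S: "subgroup S G" for S
  proof
    assume cl: "closedin (profinite_topology G) S"
    show "\<forall>x \<in> carrier G - S. \<exists>H. finite_index H G \<and> S \<subseteq> H \<and> x \<notin> H"
    proof
      fix x assume x: "x \<in> carrier G - S"
      obtain N where N: "N \<lhd> G" "finite_index N G" "N #> x \<subseteq> carrier G - S"
        using cl x unfolding closedin_def openin_profinite_topology topspace_profinite_topology
        by blast
      have sN: "subgroup N G" using normal_imp_subgroup[OF N(1)] .
      have H: "subgroup (N <#> S) G" using mult_norm_subgroup[OF N(1) S] .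
      have "N \<subseteq> N <#> S"
        using subgroup.one_closed[OF S] subgroup.subset[OF sN] by (force simp: set_mult_def)
      then have fi: "finite_index (N <#> S) G" using finite_index_mono[OF N(2) H] by simp
      have SH: "S \<subseteq> N <#> S"
        using subgroup.one_closed[OF sN] subgroup.subset[OF S] by (force simp: set_mult_def)
      have "x \<notin> N <#> S"
      proof
        assume "x \<in> N <#> S"
        then obtain n s where ns: "n \<in> N" "s \<in> S" "x = n \<otimes> s" by (auto simp: set_mult_def)
        then have c: "n \<in> carrier G" "s \<in> carrier G" using S sN by (auto dest: subgroup.mem_carrier)
        have "inv n \<otimes> x = s" using ns c by (simp add: m_assoc[symmetric])
        moreover have "inv n \<in> N" using sN ns by (simp add: subgroup.m_inv_closed)
        ultimately have "s \<in> N #> x" by (auto simp: r_coset_def)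
        then show False using N ns by blast
      qed
      then show "\<exists>H. finite_index H G \<and> S \<subseteq> H \<and> x \<notin> H" using fi SH by blast
    qed
  next
    assume sep: "\<forall>x \<in> carrier G - S. \<exists>H. finite_index H G \<and> S \<subseteq> H \<and> x \<notin> H"
    have "\<exists>N. N \<lhd> G \<and> finite_index N G \<and> N #> x \<subseteq> carrier G - S"
      if x: "x \<in> carrier G - S" for x
    proof -
      obtain H where H: "finite_index H G" "S \<subseteq> H" "x \<notin> H" using sep x by blast
      then have sH: "subgroup H G" by (simp add: finite_index_def)
      obtain N where N: "N \<lhd> G" "finite_index N G" "N \<subseteq> H" using finite_index_core[OF H(1)] by blast
      have "n \<otimes> x \<in> carrier G - S" if n: "n \<in> N" for n
      proof -
        have nH: "n \<in> H" and nc: "n \<in> carrier G" using n N sH by (auto dest: subgroup.mem_carrier)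
        have "n \<otimes> x \<notin> H"
        proof
          assume "n \<otimes> x \<in> H"
          then have "inv n \<otimes> (n \<otimes> x) \<in> H" using nH sH
            by (simp add: subgroup.m_closed subgroup.m_inv_closed)
          then show False using x nc H by (simp add: m_assoc[symmetric])
        qed
        then show ?thesis using H nc x by auto
      qed
      then show ?thesis using N by (force simp: r_coset_def)
    qed
    then show "closedin (profinite_topology G) S"
      unfolding closedin_def openin_profinite_topology topspace_profinite_topology
      using subgroup.subset[OF S] by blast
  qed
  then show ?thesis by (auto simp: ERF_def)
qed

end
end

theory Submission
  imports Defs
begin

text \<open>Polycyclic groups are ERF (Mal'cev) by induction along a series whose last step is \<open>H = K \<langle>t\<rangle>\<close>. If
  \<open>x = k s\<close> with \<open>s\<close> in \<open>S\<close> is outside \<open>S\<close>, some subgroup of finite index in \<open>K\<close> contains \<open>S \<inter> K\<close> but not \<open>k\<close>.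
  It contains the subgroup \<open>M\<close> generated by all \<open>n\<close>-th powers of \<open>K\<close> for some \<open>n\<close>, and \<open>M\<close> is normal in \<open>H\<close>
  and of finite index in \<open>K\<close>. Either \<open>M S\<close> has finite index in \<open>H\<close>, or \<open>S\<close> is inside \<open>K\<close> and a power of \<open>t\<close>
  normalizing \<open>M S\<close> is adjoined to it.

  Conversely, no subgroup of an ERF group is conjugate to a proper subgroup of itself. Applied to
  \<open>\<langle>t\<^sup>i a t\<^sup>-\<^sup>i | i \<ge> 0\<rangle>\<close>, this makes the subgroup generated by all \<open>t\<^sup>i a t\<^sup>-\<^sup>i\<close> finitely
  generated, and then the kernel of a map from a finitely generated subgroup onto a cyclic group is
  finitely generated (Milnor). Hence each term of a solvable series of the group is finitely
  generated, and its abelian factors can be refined to cyclic ones.\<close>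

context group
begin

definition conjugate :: "'a \<Rightarrow> 'a \<Rightarrow> 'a"
  where "conjugate g a = g \<otimes> a \<otimes> inv g"

text \<open>Only an inclusion is asked for. When \<open>S\<close> is a subgroup, the inverses of its
  elements turn it into an equality.\<close>

definition normalizes :: "'a set \<Rightarrow> 'a set \<Rightarrow> bool"
  where "normalizes S A \<longleftrightarrow> (\<forall>s\<in>S. \<forall>a\<in>A. conjugate s a \<in> A)"

text \<open>Says elementwise that \<open>K\<close> is normal in \<open>H\<close> and that the coset
  of \<open>t\<close> generates \<open>H / K\<close>, so that calculations take place in
  \<open>G\<close> itself. The exponent \<open>j\<close> need not be unique, as \<open>H / K\<close>
  may be finite.\<close>

definition cyclic_ext :: "'a set \<Rightarrow> 'a set \<Rightarrow> 'a \<Rightarrow> bool"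
  where "cyclic_ext K H t \<longleftrightarrow> subgroup K G \<and> subgroup H G \<and> K \<subseteq> H \<and> t \<in> H \<and> normalizes H K \<and>
    (\<forall>h\<in>H. \<exists>k\<in>K. \<exists>j::int. h = k \<otimes> t [^] j)"

definition fin_gen :: "'a set \<Rightarrow> bool"
  where "fin_gen H \<longleftrightarrow> (\<exists>A. finite A \<and> A \<subseteq> carrier G \<and> generate G A = H)"

section \<open>Conjugation and invariant subsets\<close>

lemma conjugate_closed [simp]: "\<lbrakk>g \<in> carrier G; a \<in> carrier G\<rbrakk> \<Longrightarrow> conjugate g a \<in> carrier G"
  by (simp add: conjugate_def)

lemma inv_mult_cancel [simp]:
  "\<lbrakk>x \<in> carrier G; y \<in> carrier G\<rbrakk> \<Longrightarrow> inv x \<otimes> (x \<otimes> y) = y"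
  "\<lbrakk>x \<in> carrier G; y \<in> carrier G\<rbrakk> \<Longrightarrow> x \<otimes> (inv x \<otimes> y) = y"
  by (simp_all add: m_assoc[symmetric])

lemma conjugate_mult:
  "\<lbrakk>g \<in> carrier G; a \<in> carrier G; b \<in> carrier G\<rbrakk> \<Longrightarrow> conjugate g (a \<otimes> b) = conjugate g a \<otimes> conjugate g b"
  by (simp add: conjugate_def m_assoc)

lemma conjugate_conjugate:
  "\<lbrakk>g \<in> carrier G; h \<in> carrier G; a \<in> carrier G\<rbrakk> \<Longrightarrow> conjugate g (conjugate h a) = conjugate (g \<otimes> h) a"
  by (simp add: conjugate_def m_assoc inv_mult_group)

lemma conjugate_inv: "\<lbrakk>g \<in> carrier G; a \<in> carrier G\<rbrakk> \<Longrightarrow> conjugate g (inv a) = inv (conjugate g a)"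
  by (simp add: conjugate_def m_assoc inv_mult_group)

lemma conjugate_one [simp]: "g \<in> carrier G \<Longrightarrow> conjugate g \<one> = \<one>" "a \<in> carrier G \<Longrightarrow> conjugate \<one> a = a"
  by (simp_all add: conjugate_def)

lemma conjugate_nat_pow:
  "\<lbrakk>g \<in> carrier G; a \<in> carrier G\<rbrakk> \<Longrightarrow> conjugate g (a [^] (n::nat)) = conjugate g a [^] n"
  by (induction n) (simp_all add: conjugate_mult)

lemma conjugate_int_pow:
  "\<lbrakk>t \<in> carrier G; a \<in> carrier G\<rbrakk> \<Longrightarrow>
    conjugate (t [^] (i::int)) (conjugate (t [^] (j::int)) a) = conjugate (t [^] (i + j)) a"
  by (simp add: conjugate_conjugate int_pow_mult)

lemma conjugate_generate_subset:
  assumes A: "A \<subseteq> carrier G" and B: "subgroup B G" and g: "g \<in> carrier G"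
    and AB: "\<And>a. a \<in> A \<Longrightarrow> conjugate g a \<in> B" and x: "x \<in> generate G A"
  shows "conjugate g x \<in> B"
  using x
proof (induction rule: generate.induct)
  case one
  then show ?case using g B by (simp add: subgroup.one_closed)
next
  case (incl h)
  then show ?case by (rule AB)
next
  case (inv h)
  then show ?case using A B g AB by (auto simp: conjugate_inv subgroup.m_inv_closed)
next
  case (eng h1 h2)
  then show ?case using A B g by (simp add: conjugate_mult generate_in_carrier subgroup.m_closed)
qed

lemma normalizes_generate:
  assumes "A \<subseteq> carrier G" "S \<subseteq> carrier G"
    and "\<And>s a. \<lbrakk>s \<in> S; a \<in> A\<rbrakk> \<Longrightarrow> conjugate s a \<in> generate G A"
  shows "normalizes S (generate G A)"
  using conjugate_generate_subset[OF assms(1) generate_is_subgroup[OF assms(1)]] assms(2,3)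
  unfolding normalizes_def by blast

lemma conjugate_nat_pow_mem:
  assumes A: "A \<subseteq> carrier G" and u: "u \<in> carrier G"
    and uA: "\<And>a. a \<in> A \<Longrightarrow> conjugate u a \<in> A" and a: "a \<in> A"
  shows "conjugate (u [^] (n::nat)) a \<in> A"
  using a
proof (induction n arbitrary: a)
  case 0
  then show ?case using A by auto
next
  case (Suc n)
  have "conjugate (u [^] Suc n) a = conjugate (u [^] n) (conjugate u a)"
    using Suc.prems u A by (auto simp: conjugate_conjugate)
  then show ?case using Suc.IH[OF uA[OF Suc.prems]] by simp
qed

text \<open>Invariance under \<open>t\<close> alone would not settle the negative powers:
  conjugation may carry a set onto a proper part of itself.\<close>

lemma normalizes_powers:
  assumes A: "A \<subseteq> carrier G" and t: "t \<in> carrier G"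
    and pm: "\<And>a. a \<in> A \<Longrightarrow> conjugate t a \<in> A" "\<And>a. a \<in> A \<Longrightarrow> conjugate (inv t) a \<in> A"
  shows "normalizes (range (\<lambda>i::int. t [^] i)) A"
proof -
  have "conjugate (t [^] i) a \<in> A" if a: "a \<in> A" for i :: int and a
  proof (cases i rule: int_cases2)
    case (nonneg n)
    have "conjugate (t [^] n) a \<in> A" by (rule conjugate_nat_pow_mem[OF A t pm(1) a])
    then show ?thesis unfolding nonneg int_pow_int .
  next
    case (nonpos n)
    have "conjugate (inv t [^] n) a \<in> A" by (rule conjugate_nat_pow_mem[OF A inv_closed[OF t] pm(2) a])
    then show ?thesis unfolding nonpos int_pow_neg_int[OF t] nat_pow_inv[OF t] .
  qed
  then show ?thesis unfolding normalizes_def by blast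
qed

section \<open>Products of subgroups and finite index\<close>

lemma subgroup_powers: "t \<in> carrier G \<Longrightarrow> subgroup (range (\<lambda>i::int. t [^] i)) G"
  using generate_is_subgroup[of "{t}"] by (simp add: generate_pow full_SetCompr_eq)

text \<open>An element of \<open>S\<close> moves to the right past one of \<open>A\<close> at the
  cost of conjugating the latter, which stays in \<open>A\<close>.\<close>

lemma subgroup_set_mult:
  assumes A: "subgroup A G" and S: "subgroup S G" and n: "normalizes S A"
  shows "subgroup (A <#> S) G"
proof -
  have c: "a \<in> carrier G" if "a \<in> A \<or> a \<in> S" for a
    using that A S by (auto dest: subgroup.mem_carrier)
  show ?thesis
  proof (rule subgroupI)
    show "A <#> S \<subseteq> carrier G" using c by (auto simp: set_mult_def)
    show "A <#> S \<noteq> {}" using subgroup.one_closed[OF A] subgroup.one_closed[OF S]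
      by (auto simp: set_mult_def)
  next
    fix x assume "x \<in> A <#> S"
    then obtain a s where as: "a \<in> A" "s \<in> S" "x = a \<otimes> s" by (auto simp: set_mult_def)
    have "inv x = conjugate (inv s) (inv a) \<otimes> inv s"
      using as c by (simp add: conjugate_def m_assoc inv_mult_group)
    moreover have "conjugate (inv s) (inv a) \<in> A"
      using n as A S by (simp add: normalizes_def subgroup.m_inv_closed)
    ultimately show "inv x \<in> A <#> S"
      using as subgroup.m_inv_closed[OF S] by (auto simp: set_mult_def)
  next
    fix x y assume "x \<in> A <#> S" "y \<in> A <#> S"
    then obtain a s b r where as: "a \<in> A" "s \<in> S" "x = a \<otimes> s" "b \<in> A" "r \<in> S" "y = b \<otimes> r"
      by (auto simp: set_mult_def)
    have "x \<otimes> y = (a \<otimes> conjugate s b) \<otimes> (s \<otimes> r)"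
      using as c by (simp add: conjugate_def m_assoc)
    moreover have "a \<otimes> conjugate s b \<in> A"
      using n as A by (simp add: normalizes_def subgroup.m_closed)
    ultimately show "x \<otimes> y \<in> A <#> S"
      using as subgroup.m_closed[OF S] by (auto simp: set_mult_def)
  qed
qed

text \<open>Pigeonhole: two of the \<open>card F + 1\<close> powers of \<open>y\<close> with
  exponents from 0 to \<open>card F\<close> lie in the same left coset of \<open>N\<close>, so some
  exponent between 1 and \<open>card F\<close> works for \<open>y\<close>. The factorial is a
  multiple of all of these and therefore works for every \<open>y\<close>.\<close>

lemma powers_mem_of_finite_cosets:
  assumes N: "subgroup N G" and Y: "subgroup Y G" and F: "finite F" "F \<subseteq> carrier G"
    and YF: "Y \<subseteq> F <#> N"
  shows "\<exists>n::nat. n > 0 \<and> (\<forall>y\<in>Y. y [^] n \<in> N)"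
proof (intro exI conjI ballI)
  show "(fact (card F) :: nat) > 0" by simp
next
  fix y assume y: "y \<in> Y"
  then have yc: "y \<in> carrier G" using Y by (rule subgroup.mem_carrier[rotated])
  have "\<exists>f. f \<in> F \<and> inv f \<otimes> y [^] i \<in> N" for i :: nat
  proof -
    have "y [^] i \<in> Y"
      using subgroup_int_pow_closed[OF Y y, of "int i"] by (simp add: int_pow_int)
    then obtain f n where "f \<in> F" "n \<in> N" "y [^] i = f \<otimes> n" using YF by (auto simp: set_mult_def)
    moreover from this have "f \<in> carrier G" "n \<in> carrier G" using F N by (auto dest: subgroup.mem_carrier)
    ultimately show ?thesis by (intro exI[of _ f]) simp
  qed
  then obtain f where f: "\<And>i::nat. f i \<in> F" "\<And>i. inv (f i) \<otimes> y [^] i \<in> N" by metis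
  have "\<not> inj_on f {0..card F}"
  proof
    assume "inj_on f {0..card F}"
    then have "card {0..card F} \<le> card F" using f F by (intro card_inj_on_le[of f]) auto
    then show False by simp
  qed
  then obtain i j where ij: "i < j" "j \<le> card F" "f i = f j"
    unfolding inj_on_def by (metis atLeastAtMost_iff linorder_neqE_nat)
  have fc: "f j \<in> carrier G" using f F by blast
  have "inv (inv (f i) \<otimes> y [^] i) \<otimes> (inv (f j) \<otimes> y [^] j) \<in> N"
    using f N by (simp add: subgroup.m_closed subgroup.m_inv_closed)
  also have "inv (inv (f i) \<otimes> y [^] i) \<otimes> (inv (f j) \<otimes> y [^] j) = inv (y [^] i) \<otimes> y [^] j"
    using ij fc yc by (simp add: inv_mult_group m_assoc)
  also have "y [^] j = y [^] i \<otimes> y [^] (j - i)" using ij yc by (simp add: nat_pow_mult)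
  also have "inv (y [^] i) \<otimes> \<dots> = y [^] (j - i)" using yc by simp
  finally have "y [^] (j - i) \<in> N" .
  moreover have "j - i dvd fact (card F)" using ij by (intro dvd_fact) auto
  then obtain q where "fact (card F) = (j - i) * q" by (elim dvdE)
  then have "y [^] (fact (card F) :: nat) = (y [^] (j - i)) [^] q" using yc by (simp add: nat_pow_pow)
  ultimately show "y [^] (fact (card F) :: nat) \<in> N"
    using subgroup_int_pow_closed[OF N, of "y [^] (j - i)" "int q"] by (simp add: int_pow_int)
qed

text \<open>\<open>finite_index\<close> counts right cosets, while \<open>F <#> H\<close> is a union
  of left cosets. Inversion exchanges the two kinds.\<close>

lemma finite_index_iff_finite_cosets:
  assumes H: "subgroup H G"
  shows "finite_index H G \<longleftrightarrow> (\<exists>F. finite F \<and> F \<subseteq> carrier G \<and> carrier G \<subseteq> F <#> H)"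
proof
  assume "finite_index H G"
  then have fin: "finite (rcosets H)" by (simp add: finite_index_def)
  define r where "r C = (SOME g. g \<in> carrier G \<and> H #> g = C)" for C
  have r: "r C \<in> carrier G \<and> H #> r C = C" if "C \<in> rcosets H" for C
    unfolding r_def by (rule someI_ex) (use that in \<open>auto simp: RCOSETS_def\<close>)
  have "g \<in> (\<lambda>C. inv r C) ` (rcosets H) <#> H" if g: "g \<in> carrier G" for g
  proof -
    have C: "H #> inv g \<in> rcosets H" using g by (auto simp: RCOSETS_def)
    have rc: "r (H #> inv g) \<in> carrier G" using r[OF C] by simp
    have "r (H #> inv g) \<in> H #> inv g" using rcos_self[OF rc H] r[OF C] by simp
    then obtain h where h: "h \<in> H" "r (H #> inv g) = h \<otimes> inv g" by (auto simp: r_coset_def)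
    then have "g = inv (r (H #> inv g)) \<otimes> h"
      using g H by (simp add: inv_mult_group m_assoc subgroup.mem_carrier)
    then show ?thesis using h C unfolding set_mult_def by blast
  qed
  then show "\<exists>F. finite F \<and> F \<subseteq> carrier G \<and> carrier G \<subseteq> F <#> H"
    using fin r by (intro exI[of _ "(\<lambda>C. inv r C) ` (rcosets H)"]) auto
next
  assume "\<exists>F. finite F \<and> F \<subseteq> carrier G \<and> carrier G \<subseteq> F <#> H"
  then obtain F where F: "finite F" "F \<subseteq> carrier G" "carrier G \<subseteq> F <#> H" by blast
  have "rcosets H \<subseteq> (\<lambda>f. H #> inv f) ` F"
  proof
    fix C assume "C \<in> rcosets H"
    then obtain g where g: "g \<in> carrier G" "C = H #> g" by (auto simp: RCOSETS_def)
    then have "inv g \<in> F <#> H" using F by auto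
    then obtain f h where fh: "f \<in> F" "h \<in> H" "inv g = f \<otimes> h" by (auto simp: set_mult_def)
    have hc: "h \<in> carrier G" and fc: "f \<in> carrier G"
      using fh F H by (auto dest: subgroup.mem_carrier)
    have "g = inv h \<otimes> inv f" using fh g hc fc inv_inv[of g] by (simp add: inv_mult_group)
    then have "g \<in> H #> inv f" using fh H by (auto simp: r_coset_def subgroup.m_inv_closed)
    then have "C = H #> inv f" using g repr_independence[OF _ _ H] fc by simp
    then show "C \<in> (\<lambda>f. H #> inv f) ` F" using fh by blast
  qed
  then have "finite (rcosets H)" using F(1) by (rule finite_surj[rotated])
  then show "finite_index H G" using H by (simp add: finite_index_def)
qed

lemma finite_index_powers_mem:
  assumes "finite_index H G"
  shows "\<exists>n::nat. n > 0 \<and> (\<forall>y\<in>carrier G. y [^] n \<in> H)"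
proof -
  have H: "subgroup H G" using assms by (simp add: finite_index_def)
  obtain F where "finite F" "F \<subseteq> carrier G" "carrier G \<subseteq> F <#> H"
    using assms finite_index_iff_finite_cosets[OF H] by auto
  then show ?thesis by (rule powers_mem_of_finite_cosets[OF H subgroup_self])
qed

section \<open>Cyclic extensions and polycyclic series\<close>

lemma normal_restrict_iff:
  assumes K: "subgroup K G" and H: "subgroup H G" and KH: "K \<subseteq> H"
  shows "K \<lhd> G\<lparr>carrier := H\<rparr> \<longleftrightarrow> normalizes H K"
proof -
  interpret H: group "G\<lparr>carrier := H\<rparr>" using H by (rule subgroup_imp_group)
  show ?thesis unfolding H.normal_inv_iff normalizes_def conjugate_def
    using subgroup_incl[OF K H KH] by (auto simp: m_inv_consistent[OF H])
qed

text \<open>Any representative of a generator of the factor group serves as \<open>t\<close>,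
  because the projection sends powers of \<open>t\<close> to powers of that generator.\<close>

lemma cyclic_quotient_imp_cyclic_ext:
  assumes H: "subgroup H G" and n: "K \<lhd> G\<lparr>carrier := H\<rparr>"
    and cyc: "cyclic_group (G\<lparr>carrier := H\<rparr> Mod K)"
  shows "\<exists>t. cyclic_ext K H t"
proof -
  interpret n: normal K "G\<lparr>carrier := H\<rparr>" by (rule n)
  interpret Q: group "G\<lparr>carrier := H\<rparr> Mod K" by (rule n.factorgroup_is_group)
  have KH: "K \<subseteq> H" using n.subset by simp
  have K: "subgroup K G" using incl_subgroup[OF H n.subgroup_axioms] .
  interpret h: group_hom "G\<lparr>carrier := H\<rparr>" "G\<lparr>carrier := H\<rparr> Mod K" "\<lambda>a. K #>\<^bsub>G\<lparr>carrier := H\<rparr>\<^esub> a"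
    using n.r_coset_hom_Mod by unfold_locales
  obtain x where x: "x \<in> carrier (G\<lparr>carrier := H\<rparr> Mod K)"
    "carrier (G\<lparr>carrier := H\<rparr> Mod K) = range (\<lambda>n::int. x [^]\<^bsub>G\<lparr>carrier := H\<rparr> Mod K\<^esub> n)"
    using cyc unfolding Q.cyclic_group by blast
  obtain t where t: "t \<in> H" "x = K #>\<^bsub>G\<lparr>carrier := H\<rparr>\<^esub> t" using x(1) by (auto simp: carrier_FactGroup)
  have "\<exists>k\<in>K. \<exists>j::int. h = k \<otimes> t [^] j" if h: "h \<in> H" for h
  proof -
    have "K #>\<^bsub>G\<lparr>carrier := H\<rparr>\<^esub> h \<in> carrier (G\<lparr>carrier := H\<rparr> Mod K)"
      using h by (auto simp: carrier_FactGroup)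
    then obtain j :: int where "K #>\<^bsub>G\<lparr>carrier := H\<rparr>\<^esub> h = x [^]\<^bsub>G\<lparr>carrier := H\<rparr> Mod K\<^esub> j" using x(2) by auto
    also have "\<dots> = K #>\<^bsub>G\<lparr>carrier := H\<rparr>\<^esub> (t [^]\<^bsub>G\<lparr>carrier := H\<rparr>\<^esub> j)" using t h.hom_int_pow[of t j] by simp
    also have "t [^]\<^bsub>G\<lparr>carrier := H\<rparr>\<^esub> j = t [^] j" using int_pow_consistent[OF H t(1)] by simp
    finally have "h \<in> K #>\<^bsub>G\<lparr>carrier := H\<rparr>\<^esub> (t [^] j)" 
      using n.rcos_self[of h K] h n.subgroup_axioms by (simp add: r_coset_def)
    then show ?thesis by (auto simp: r_coset_def)
  qed
  then show ?thesis using K H KH t normal_restrict_iff[OF K H KH] n by (auto simp: cyclic_ext_def)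
qed

lemma cyclic_ext_imp_cyclic_quotient:
  assumes ext: "cyclic_ext K H t"
  shows "cyclic_group (G\<lparr>carrier := H\<rparr> Mod K)"
proof -
  have H: "subgroup H G" and t: "t \<in> H" and n: "K \<lhd> G\<lparr>carrier := H\<rparr>"
    using ext normal_restrict_iff[of K H] by (auto simp: cyclic_ext_def)
  interpret n: normal K "G\<lparr>carrier := H\<rparr>" by (rule n)
  interpret Q: group "G\<lparr>carrier := H\<rparr> Mod K" by (rule n.factorgroup_is_group)
  interpret h: group_hom "G\<lparr>carrier := H\<rparr>" "G\<lparr>carrier := H\<rparr> Mod K" "\<lambda>a. K #>\<^bsub>G\<lparr>carrier := H\<rparr>\<^esub> a"
    using n.r_coset_hom_Mod by unfold_locales
  let ?x = "K #>\<^bsub>G\<lparr>carrier := H\<rparr>\<^esub> t"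
  have xQ: "?x \<in> carrier (G\<lparr>carrier := H\<rparr> Mod K)" using t by (auto simp: carrier_FactGroup)
  have pow: "?x [^]\<^bsub>G\<lparr>carrier := H\<rparr> Mod K\<^esub> j = K #> (t [^] j)" for j :: int
    using t h.hom_int_pow[of t j] int_pow_consistent[OF H t, of j] by (simp add: r_coset_def)
  have "C \<in> range (\<lambda>j::int. ?x [^]\<^bsub>G\<lparr>carrier := H\<rparr> Mod K\<^esub> j)"
    if C: "C \<in> carrier (G\<lparr>carrier := H\<rparr> Mod K)" for C
  proof -
    obtain h where h: "h \<in> H" "C = K #> h" using C by (auto simp: carrier_FactGroup r_coset_def)
    then obtain k and j :: int where k: "k \<in> K" "h = k \<otimes> t [^] j" using ext by (auto simp: cyclic_ext_def)
    have c: "K \<subseteq> carrier G" "subgroup K G" "t \<in> carrier G" "k \<in> carrier G"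
      using ext k t H by (auto simp: cyclic_ext_def dest: subgroup.mem_carrier)
    have "h \<in> K #> t [^] j" using k by (auto simp: r_coset_def)
    then have "C = K #> t [^] j" using repr_independence[of h K "t [^] j"] c h by simp
    then show ?thesis using pow by blast
  qed
  then have "carrier (G\<lparr>carrier := H\<rparr> Mod K) = range (\<lambda>j::int. ?x [^]\<^bsub>G\<lparr>carrier := H\<rparr> Mod K\<^esub> j)"
    using Q.int_pow_closed[OF xQ] by auto
  then show ?thesis unfolding Q.cyclic_group using xQ by blast
qed

lemma polycyclic_seq_cyclic_ext:
  assumes "polycyclic_seq G K" "cyclic_ext K H t"
  shows "polycyclic_seq G H"
proof (rule polycyclic_seq.extension[OF assms(1)])
  show "subgroup H G" "K \<lhd> G\<lparr>carrier := H\<rparr>"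
    using assms(2) normal_restrict_iff[of K H] by (simp_all add: cyclic_ext_def)
qed (rule cyclic_ext_imp_cyclic_quotient[OF assms(2)])

text \<open>Trades the cyclic factor group of the original rule for an element \<open>t\<close>, so
  that later inductions need no factor groups.\<close>

lemma polycyclic_seq_induct [consumes 1, case_names unity extension]:
  assumes "polycyclic_seq G H"
    and "P {\<one>}"
    and "\<And>K H t. \<lbrakk>polycyclic_seq G K; P K; cyclic_ext K H t\<rbrakk> \<Longrightarrow> P H"
  shows "P H"
  using assms(1)
proof (induction rule: polycyclic_seq.induct)
  case (extension K H)
  obtain t where "cyclic_ext K H t"
    using cyclic_quotient_imp_cyclic_ext[OF extension.hyps(3,2,4)] by blast
  then show ?case by (rule assms(3)[OF extension.hyps(1) extension.IH])
qed (rule assms(2))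

lemma cyclic_extD:
  assumes "cyclic_ext K H t"
  shows "subgroup K G" "subgroup H G" "K \<subseteq> H" "t \<in> H" "t \<in> carrier G" "K \<subseteq> carrier G"
    "H \<subseteq> carrier G" "\<And>h k. \<lbrakk>h \<in> H; k \<in> K\<rbrakk> \<Longrightarrow> conjugate h k \<in> K"
    "\<And>j::int. t [^] j \<in> H"
    "\<And>h. h \<in> H \<Longrightarrow> \<exists>k\<in>K. \<exists>j::int. h = k \<otimes> t [^] j"
  using assms subgroup_int_pow_closed[of H t]
  by (auto simp: cyclic_ext_def normalizes_def dest: subgroup.mem_carrier)

lemma subset_set_mult:
  assumes "subgroup A G" "subgroup B G"
  shows "A \<subseteq> A <#> B" "B \<subseteq> A <#> B"
  using assms[THEN subgroup.one_closed] assms[THEN subgroup.subset]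
  by (force simp: set_mult_def)+

lemma set_mult_mono: "\<lbrakk>A \<subseteq> B; C \<subseteq> D\<rbrakk> \<Longrightarrow> A <#> C \<subseteq> B <#> D"
  by (auto simp: set_mult_def)

text \<open>Modulo \<open>K\<close> the exponents of \<open>t\<close> just multiply. Collecting the
  powers of \<open>t\<close> on the right only conjugates elements of the normal subgroup
  \<open>K\<close>.\<close>

lemma cyclic_ext_nat_pow:
  assumes ext: "cyclic_ext K H t" and k: "k \<in> K"
  shows "\<exists>k'\<in>K. (k \<otimes> t [^] (j::int)) [^] (p::nat) = k' \<otimes> t [^] (j * int p)"
proof (induction p)
  case 0
  then show ?case using subgroup.one_closed[OF cyclic_extD(1)[OF ext]]
    by (intro bexI[of _ \<one>]) auto
next
  case (Suc p)
  note D = cyclic_extD[OF ext]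
  obtain k' where k': "k' \<in> K" "(k \<otimes> t [^] j) [^] p = k' \<otimes> t [^] (j * int p)" using Suc by blast
  have c: "k \<in> carrier G" "k' \<in> carrier G" using k k' D(6) by auto
  have "(k \<otimes> t [^] j) [^] Suc p = k' \<otimes> (t [^] (j * int p) \<otimes> k) \<otimes> t [^] j"
    using k' c D(5) by (simp add: m_assoc)
  also have "\<dots> = (k' \<otimes> conjugate (t [^] (j * int p)) k) \<otimes> (t [^] (j * int p) \<otimes> t [^] j)"
    using c D(5) by (simp add: conjugate_def m_assoc)
  also have "t [^] (j * int p) \<otimes> t [^] j = t [^] (j * int (Suc p))"
    using D(5) by (simp add: int_pow_mult[symmetric] algebra_simps)
  finally show ?case using subgroup.m_closed[OF D(1) k'(1) D(8)[OF D(9) k]] by blast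
qed

subsection \<open>Subgroup separability of polycyclic groups\<close>

text \<open>For trivial \<open>N\<close> this is the finiteness of polycyclic groups of finite
  exponent. Along the series, the exponent of \<open>t\<close> matters only modulo \<open>n\<close>,
  so each step multiplies the number of representatives by at most \<open>n\<close>.\<close>

lemma polycyclic_seq_finite_cosets:
  assumes "polycyclic_seq G K" and N: "subgroup N G" and n: "(n::nat) > 0"
    and "\<And>k. k \<in> K \<Longrightarrow> k [^] n \<in> N"
  shows "\<exists>F. finite F \<and> F \<subseteq> K \<and> K \<subseteq> F <#> N"
  using assms(1,4)
proof (induction rule: polycyclic_seq_induct)
  case unity
  have "{\<one>} \<subseteq> {\<one>} <#> N" using subgroup.one_closed[OF N] by (force simp: set_mult_def)
  then show ?case by blast
next
  case (extension K H t)
  note D = cyclic_extD[OF extension.hyps(2)]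
  obtain F where F: "finite F" "F \<subseteq> K" "K \<subseteq> F <#> N"
    using extension.IH extension.prems D(3) by blast
  define F' where "F' = (\<lambda>(i::int, f). t [^] i \<otimes> f) ` ({0..<int n} \<times> F)"
  have "finite F'" using F by (simp add: F'_def)
  moreover have "F' \<subseteq> H"
  proof
    fix y assume "y \<in> F'"
    then obtain i :: int and f where "f \<in> F" "y = t [^] i \<otimes> f" by (auto simp: F'_def)
    then show "y \<in> H" using subgroup.m_closed[OF D(2) D(9)] F(2) D(3) by blast
  qed
  moreover have "h \<in> F' <#> N" if h: "h \<in> H" for h
  proof -
    obtain k and j :: int where k: "k \<in> K" "h = k \<otimes> t [^] j" using D(10)[OF h] by blast
    define i q where "i = j mod int n" and "q = j div int n"
    have i: "i \<in> {0..<int n}" using n by (simp add: i_def)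
    \<comment> \<open>Moving \<open>t [^] i\<close> to the left of \<open>k\<close> conjugates
      \<open>k\<close>; the result is then split by \<open>F\<close> and \<open>N\<close>, and the
      \<open>N\<close>-part joins the power of \<open>t [^] n\<close>.\<close>
    have "conjugate (t [^] (- i)) k \<in> K" using D(8)[OF D(9) k(1)] .
    then obtain f y where fy: "f \<in> F" "y \<in> N" "conjugate (t [^] (- i)) k = f \<otimes> y"
      using F(3) unfolding set_mult_def by blast
    have c: "k \<in> carrier G" "f \<in> carrier G" "y \<in> carrier G"
      using k fy F(2) D(6) N by (auto dest: subgroup.mem_carrier)
    have tN: "(t [^] n) [^] q \<in> N"
      using subgroup_int_pow_closed[OF N extension.prems[OF D(4)]] .
    have "t [^] j = t [^] i \<otimes> (t [^] n) [^] q"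
    proof -
      have "j = i + int n * q" by (simp add: i_def q_def)
      then show ?thesis using D(5)
        by (simp add: int_pow_mult int_pow_pow[symmetric] int_pow_int)
    qed
    moreover have "t [^] i \<otimes> (f \<otimes> y) = k \<otimes> t [^] i"
      unfolding fy(3)[symmetric] using c D(5) by (simp add: conjugate_def int_pow_neg m_assoc)
    ultimately have "h = (t [^] i \<otimes> f) \<otimes> (y \<otimes> (t [^] n) [^] q)"
      using k c D(5) by (metis int_pow_closed m_assoc m_closed nat_pow_closed)
    moreover have "t [^] i \<otimes> f \<in> F'" using i fy by (force simp: F'_def)
    ultimately show ?thesis
      using subgroup.m_closed[OF N fy(2) tN] unfolding set_mult_def by blast
  qed
  ultimately show ?case by blast
qed

lemma separate_in_cyclic_ext:
  assumes ext: "cyclic_ext K H t"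
    and M: "subgroup M G" "M \<subseteq> K" "normalizes H M"
    and F: "finite F" "F \<subseteq> K" "K \<subseteq> F <#> M"
    and S: "subgroup S G" "S \<subseteq> H" and x: "x \<in> H" "x \<notin> M <#> S"
  shows "\<exists>N. subgroup N G \<and> S \<subseteq> N \<and> x \<notin> N \<and> (\<exists>n::nat. n > 0 \<and> (\<forall>h\<in>H. h [^] n \<in> N))"
proof -
  note D = cyclic_extD[OF ext]
  define W where "W = M <#> S"
  have nS: "normalizes S M" "normalizes S K"
    using M(3) S(2) D(8) by (auto simp: normalizes_def)
  have W: "subgroup W G" unfolding W_def by (rule subgroup_set_mult[OF M(1) S(1) nS(1)])
  have MW: "M \<subseteq> W" and SW: "S \<subseteq> W" unfolding W_def using subset_set_mult[OF M(1) S(1)] by auto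
  have xW: "x \<notin> W" using x by (simp add: W_def)
  have Fc: "F \<subseteq> carrier G" and Mc: "M \<subseteq> carrier G" using F(2) M(2) D(6) by auto
  \<comment> \<open>Common end of both cases. \<open>Y\<close> is an intermediate subgroup that
    contains all \<open>p\<close>-th powers of \<open>H\<close> and is covered by finitely many
    cosets of \<open>N\<close>, so a multiple of \<open>p\<close> brings all powers into
    \<open>N\<close>.\<close>
  have finish: ?thesis
    if N: "subgroup N G" "W \<subseteq> N" "x \<notin> N" and Y: "subgroup Y G" "Y \<subseteq> F <#> N"
      and p: "p > 0" "\<And>h. h \<in> H \<Longrightarrow> h [^] p \<in> Y" for N Y and p :: nat
  proof -
    obtain n :: nat where n: "n > 0" "\<And>y. y \<in> Y \<Longrightarrow> y [^] n \<in> N"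
      using powers_mem_of_finite_cosets[OF N(1) Y(1) F(1) Fc Y(2)] by blast
    have "h [^] (p * n) \<in> N" if "h \<in> H" for h
      using n(2)[OF p(2)[OF that]] that D(7) by (auto simp: nat_pow_pow)
    moreover have "p * n > 0" using p n by simp
    ultimately show ?thesis using N SW by blast
  qed
  show ?thesis
  \<comment> \<open>The first case also includes every finite factor \<open>H / K\<close>: if a
    nonzero power of \<open>t\<close> lies in \<open>K\<close>, then \<open>s = \<one>\<close>
    qualifies.\<close>
  proof (cases "\<exists>s\<in>S. \<exists>k\<in>K. \<exists>m::int. m \<noteq> 0 \<and> s = k \<otimes> t [^] m")
    case True
    then obtain s k and m :: int where s: "s \<in> S" "k \<in> K" "m \<noteq> 0" "s = k \<otimes> t [^] m" by blast
    have KS: "subgroup (K <#> S) G" by (rule subgroup_set_mult[OF D(1) S(1) nS(2)])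
    have kc: "k \<in> carrier G" using s D(6) by auto
    have "t [^] m = inv k \<otimes> s" using s kc D(5) by simp
    then have tm: "t [^] m \<in> K <#> S"
      using s subgroup.m_inv_closed[OF D(1)] by (auto simp: set_mult_def)
    show ?thesis
    proof (rule finish[OF W order_refl xW KS])
      show "K <#> S \<subseteq> F <#> W"
        using set_mult_mono[OF F(3) order_refl, of S]
          set_mult_assoc[OF Fc Mc subgroup.subset[OF S(1)]] by (simp add: W_def)
      show "nat \<bar>m\<bar> > 0" using s by simp
      fix h assume "h \<in> H"
      then obtain b and j :: int where b: "b \<in> K" "h = b \<otimes> t [^] j" using D(10) by blast
      obtain b' where b': "b' \<in> K" "h [^] nat \<bar>m\<bar> = b' \<otimes> t [^] (j * int (nat \<bar>m\<bar>))"
        using cyclic_ext_nat_pow[OF ext b(1)] b(2) by blast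
      have "j * int (nat \<bar>m\<bar>) = m * (j * sgn m)" by (simp add: abs_if sgn_if)
      then have "t [^] (j * int (nat \<bar>m\<bar>)) = (t [^] m) [^] (j * sgn m)"
        using D(5) by (simp only: int_pow_pow)
      also have "\<dots> \<in> K <#> S" by (rule subgroup_int_pow_closed[OF KS tm])
      finally show "h [^] nat \<bar>m\<bar> \<in> K <#> S"
        using b' subgroup.m_closed[OF KS] subset_set_mult(1)[OF D(1) S(1)] by auto
    qed
  next
    case False
    have SK: "S \<subseteq> K"
    proof
      fix s assume s: "s \<in> S"
      then obtain k and j :: int where k: "k \<in> K" "s = k \<otimes> t [^] j" using D(10) S by blast
      then have "j = 0" using False s by blast
      then show "s \<in> K" using k D(6) by auto
    qed
    \<comment> \<open>So \<open>H / K\<close> is infinite cyclic in this case, and exponents of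
      \<open>t\<close> are determined modulo \<open>K\<close>.\<close>
    have t0: "p = 0" if p: "t [^] (p::int) \<in> K" for p
    proof (rule ccontr)
      assume "p \<noteq> 0"
      moreover have "\<one> = inv (t [^] p) \<otimes> t [^] p" using D(5) by simp
      ultimately show False
        using False subgroup.one_closed[OF S(1)] subgroup.m_inv_closed[OF D(1) p] by blast
    qed
    have WK: "W \<subseteq> K"
      unfolding W_def using M(2) SK subgroup.m_closed[OF D(1)] by (auto simp: set_mult_def)
    \<comment> \<open>\<open>g i c \<in> W\<close> says that \<open>c\<close> lies in the conjugate
      of \<open>W\<close> by \<open>t [^] i\<close>. This conjugate is a union of cosets
      \<open>f M\<close> inside \<open>K\<close>, so it is determined by a subset of the finite set
      \<open>F\<close>. Hence two such conjugates coincide, and \<open>t [^] (j - i)\<close>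
      normalizes \<open>W\<close>.\<close>
    define g where "g i c = conjugate (t [^] (- int i)) c" for i c
    have gM: "g i c \<in> W" if "c \<in> M" for i c
      unfolding g_def using M(3) D(9) that MW by (auto simp: normalizes_def)
    have "\<not> inj (\<lambda>i. {f \<in> F. g i f \<in> W})"
    proof
      assume "inj (\<lambda>i. {f \<in> F. g i f \<in> W})"
      moreover have "finite (range (\<lambda>i. {f \<in> F. g i f \<in> W}))"
        by (rule finite_subset[of _ "Pow F"]) (use F(1) in auto)
      ultimately show False using finite_imageD infinite_UNIV_nat by blast
    qed
    then obtain i j where ij: "i < j" "{f \<in> F. g i f \<in> W} = {f \<in> F. g j f \<in> W}"
      unfolding inj_def by (metis linorder_neqE_nat)
    have g_iff: "g l (f \<otimes> y) \<in> W \<longleftrightarrow> g l f \<in> W" if "f \<in> F" "y \<in> M" for l f y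
    proof -
      have c: "f \<in> carrier G" "y \<in> carrier G" using that Fc Mc by auto
      then have "g l (f \<otimes> y) = g l f \<otimes> g l y" using D(5) by (simp add: g_def conjugate_mult)
      moreover have "g l f \<in> carrier G" "g l y \<in> carrier G" using c D(5) by (simp_all add: g_def)
      ultimately show ?thesis using gM[OF that(2), of l] W
        by (metis inv_closed inv_mult_cancel m_assoc r_inv r_one subgroup.m_closed subgroup.m_inv_closed)
    qed
    have gij: "g i c \<in> W \<longleftrightarrow> g j c \<in> W" if c: "c \<in> K" for c
    proof -
      obtain f y where "f \<in> F" "y \<in> M" "c = f \<otimes> y" using c F(3) unfolding set_mult_def by blast
      then show ?thesis using g_iff ij(2) by blast
    qed
    define q where "q = int j - int i"
    have q: "q > 0" using ij by (simp add: q_def)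
    have up: "conjugate (t [^] q) w \<in> W" and down: "conjugate (inv (t [^] q)) w \<in> W" if w: "w \<in> W" for w
    proof -
      have wc: "w \<in> carrier G" "w \<in> K" using w WK D(6) by auto
      \<comment> \<open>Testing these two conjugates of \<open>w\<close> in \<open>gij\<close>
        yields the two directions: one side of each equivalence is \<open>w \<in> W\<close>.\<close>
      have "conjugate (t [^] int j) w \<in> K" "conjugate (t [^] int i) w \<in> K"
        using D(8)[OF D(9) wc(2)] by auto
      note gg = gij[OF this(1)] gij[OF this(2)]
      have *: "g a (conjugate (t [^] int b) w) = conjugate (t [^] (int b - int a)) w" for a b
        using wc D(5) by (simp add: g_def conjugate_int_pow)
      have "inv (t [^] q) = t [^] (int i - int j)"
        using int_pow_neg[OF D(5), of q] by (simp add: q_def)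
      then show "conjugate (t [^] q) w \<in> W" "conjugate (inv (t [^] q)) w \<in> W"
        using gg w wc unfolding * q_def by auto
    qed
    obtain k and l :: int where k: "k \<in> K" "x = k \<otimes> t [^] l" using D(10) x by blast
    \<comment> \<open>The exponent exceeds \<open>\<bar>l\<bar>\<close>, so that no nonzero power of \<open>u\<close> lies in \<open>K x\<close>.\<close>
    define u where "u = (t [^] q) [^] (\<bar>l\<bar> + 1)"
    have u: "u = t [^] (q * (\<bar>l\<bar> + 1))" "u \<in> carrier G" using D(5) by (simp_all add: u_def int_pow_pow)
    have "normalizes (range (\<lambda>i::int. (t [^] q) [^] i)) W"
      using normalizes_powers[of W "t [^] q"] up down WK D(5,6) by blast
    moreover have "u [^] i = (t [^] q) [^] ((\<bar>l\<bar> + 1) * i)" for i :: int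
      unfolding u_def using D(5) by (simp add: int_pow_pow mult.assoc)
    ultimately have nW: "normalizes (range (\<lambda>i::int. u [^] i)) W"
      by (auto simp: normalizes_def)
    let ?P = "range (\<lambda>i::int. u [^] i)"
    have P: "subgroup ?P G" using subgroup_powers[OF u(2)] .
    have pH: "?P \<subseteq> H" using subgroup_int_pow_closed[OF D(2) D(9)] u(1) by auto
    have nK: "normalizes ?P K" using D(8)[OF subsetD[OF pH]] unfolding normalizes_def by blast
    have N: "subgroup (W <#> ?P) G" by (rule subgroup_set_mult[OF W P nW])
    have Y: "subgroup (K <#> ?P) G" by (rule subgroup_set_mult[OF D(1) P nK])
    show ?thesis
    proof (rule finish[OF N _ _ Y])
      show "W \<subseteq> W <#> ?P" using subset_set_mult(1)[OF W P] .
      show "K <#> ?P \<subseteq> F <#> (W <#> ?P)"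
        using set_mult_mono[OF F(3) order_refl, of ?P] set_mult_assoc[OF Fc Mc subgroup.subset[OF P]]
          set_mult_mono[OF order_refl set_mult_mono[OF MW order_refl], of F ?P] by simp
      show "nat (q * (\<bar>l\<bar> + 1)) > 0" using q by simp
      show "x \<notin> W <#> ?P"
      proof
        assume "x \<in> W <#> ?P"
        then obtain w and a :: int where w: "w \<in> W" "x = w \<otimes> u [^] a" by (auto simp: set_mult_def)
        \<comment> \<open>The two expressions for \<open>x\<close> have equal exponents of
          \<open>t\<close>, so \<open>l\<close> is a multiple of a number larger than its absolute
          value. This forces \<open>a = 0\<close>, and then \<open>x = w\<close> lies in
          \<open>W\<close>.\<close>
        define b where "b = q * (\<bar>l\<bar> + 1) * a"
        have xb: "k \<otimes> t [^] l = w \<otimes> t [^] b" using w k u(1) D(5) by (simp add: int_pow_pow b_def)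
        have c: "k \<in> carrier G" "w \<in> carrier G" "w \<in> K" using k w WK D(6) by auto
        have "inv k \<otimes> (k \<otimes> t [^] l) \<otimes> inv (t [^] b) = inv k \<otimes> w"
          unfolding xb using c D(5) by (simp add: m_assoc)
        then have "t [^] (l - b) = inv k \<otimes> w" using c D(5) by (simp add: int_pow_diff)
        then have "t [^] (l - b) \<in> K"
          using subgroup.m_closed[OF D(1) subgroup.m_inv_closed[OF D(1) k(1)] c(3)] by simp
        then have "l - b = 0" by (rule t0)
        then have l: "l = q * (\<bar>l\<bar> + 1) * a" by (simp add: b_def)
        have "a = 0"
        proof (rule ccontr)
          assume "a \<noteq> 0"
          then have "\<bar>l\<bar> + 1 \<le> (\<bar>l\<bar> + 1) * \<bar>a\<bar>" 
            using mult_left_mono[of 1 "\<bar>a\<bar>" "\<bar>l\<bar> + 1"] by simp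
          also have "\<dots> \<le> q * ((\<bar>l\<bar> + 1) * \<bar>a\<bar>)"
            using q mult_right_mono[of 1 q "(\<bar>l\<bar> + 1) * \<bar>a\<bar>"] by simp
          also have "\<dots> = \<bar>q * (\<bar>l\<bar> + 1) * a\<bar>" using q by (simp add: abs_mult)
          finally show False using l by simp
        qed
        then show False using w xW c by simp
      qed
      fix h assume "h \<in> H"
      then obtain b and j :: int where b: "b \<in> K" "h = b \<otimes> t [^] j" using D(10) by blast
      let ?p = "nat (q * (\<bar>l\<bar> + 1))"
      obtain b' where b': "b' \<in> K" "h [^] ?p = b' \<otimes> t [^] (j * int ?p)"
        using cyclic_ext_nat_pow[OF ext b(1)] b(2) by blast
      have "t [^] (j * int ?p) = u [^] j"
        unfolding u(1) using D(5) q by (simp add: int_pow_pow mult.commute)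
      then show "h [^] ?p \<in> K <#> ?P" using b' by (auto simp: set_mult_def)
    qed
  qed
qed

text \<open>Finite index in \<open>H\<close> is expressed by a uniform power of \<open>H\<close>
  landing in \<open>N\<close>. This form does not tie \<open>N\<close> to \<open>H\<close>, supplies
  the powers that generate \<open>M\<close> in the next step, and is turned into finitely many
  cosets by \<open>polycyclic_seq_finite_cosets\<close>.\<close>

lemma polycyclic_seq_separable:
  assumes "polycyclic_seq G H" "subgroup S G" "S \<subseteq> H" "x \<in> H" "x \<notin> S"
  shows "\<exists>N. subgroup N G \<and> S \<subseteq> N \<and> x \<notin> N \<and> (\<exists>n::nat. n > 0 \<and> (\<forall>h\<in>H. h [^] n \<in> N))"
  using assms
proof (induction arbitrary: S x rule: polycyclic_seq_induct)
  case unity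
  then show ?case using subgroup.one_closed by fastforce
next
  case (extension K H t)
  note D = cyclic_extD[OF extension.hyps(2)]
  note S = extension.prems(1,2)
  have "\<exists>M F. subgroup M G \<and> M \<subseteq> K \<and> normalizes H M \<and> finite F \<and> F \<subseteq> K \<and> K \<subseteq> F <#> M \<and> x \<notin> M <#> S"
  proof (cases "x \<in> K <#> S")
    case False
    have "K \<subseteq> {\<one>} <#> K" using D(6) by (force simp: set_mult_def)
    moreover have "normalizes H K" using D(8) by (simp add: normalizes_def)
    ultimately show ?thesis using D(1) False subgroup.one_closed[OF D(1)]
      by (intro exI[of _ K] exI[of _ "{\<one>}"]) simp
  next
    case True
    then obtain k s where ks: "k \<in> K" "s \<in> S" "x = k \<otimes> s" by (auto simp: set_mult_def)
    \<comment> \<open>Separating \<open>x\<close> from \<open>S\<close> is thereby reduced to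
      separating \<open>k\<close> from \<open>K \<inter> S\<close> inside \<open>K\<close>.\<close>
    have "k \<notin> S" using ks extension.prems(4) subgroup.m_closed[OF S(1)] by blast
    then obtain L n where L: "subgroup L G" "K \<inter> S \<subseteq> L" "k \<notin> L"
        "(n::nat) > 0" "\<And>y. y \<in> K \<Longrightarrow> y [^] n \<in> L"
      using extension.IH[OF subgroups_Inter_pair[OF D(1) S(1)], of k] ks by blast
    \<comment> \<open>\<open>L\<close> need not be invariant under \<open>H\<close>, but the set of
      \<open>n\<close>-th powers of \<open>K\<close> is, so the subgroup it generates replaces
      \<open>L\<close>.\<close>
    define R where "R = (\<lambda>y. y [^] n) ` K"
    define M where "M = generate G R"
    have RK: "R \<subseteq> K"
      unfolding R_def using subgroup_int_pow_closed[OF D(1), of _ "int n"] by (auto simp: int_pow_int)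
    have Rc: "R \<subseteq> carrier G" using RK D(6) by blast
    have M: "subgroup M G" unfolding M_def by (rule generate_is_subgroup[OF Rc])
    have MK: "M \<subseteq> K" unfolding M_def by (rule generate_subgroup_incl[OF RK D(1)])
    have M_sub_L: "M \<subseteq> L"
      unfolding M_def by (rule generate_subgroup_incl[OF _ L(1)]) (use L(5) in \<open>auto simp: R_def\<close>)
    have nM: "normalizes H M"
      unfolding M_def
    proof (rule normalizes_generate[OF Rc D(7)])
      fix h r assume h: "h \<in> H" and "r \<in> R"
      then obtain y where y: "y \<in> K" "r = y [^] n" by (auto simp: R_def)
      then have "conjugate h r = conjugate h y [^] n" using h D(6,7) by (auto intro: conjugate_nat_pow)
      then have "conjugate h r \<in> R" using D(8)[OF h y(1)] by (simp add: R_def)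
      then show "conjugate h r \<in> generate G R" by (rule generate.incl)
    qed
    have "\<And>y. y \<in> K \<Longrightarrow> y [^] n \<in> M" unfolding M_def R_def by (auto intro: generate.incl)
    then obtain F where "finite F" "F \<subseteq> K" "K \<subseteq> F <#> M"
      using polycyclic_seq_finite_cosets[OF extension.hyps(1) M L(4)] by blast
    moreover have "x \<notin> M <#> S"
    proof
      assume "x \<in> M <#> S"
      then obtain m r where mr: "m \<in> M" "r \<in> S" "x = m \<otimes> r" by (auto simp: set_mult_def)
      have c: "k \<in> carrier G" "s \<in> carrier G" "m \<in> carrier G" "r \<in> carrier G"
        using ks mr MK D(6) S(1) by (auto dest: subgroup.mem_carrier)
      \<comment> \<open>Both factors lie in \<open>L\<close>: \<open>m\<close> through
        \<open>M\<close>, and \<open>r \<otimes> inv s\<close> because it belongs to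
        \<open>S\<close> and, being \<open>inv m \<otimes> k\<close>, also to
        \<open>K\<close>.\<close>
      have "k = m \<otimes> (r \<otimes> inv s)"
      proof -
        have "k = k \<otimes> s \<otimes> inv s" using c by (simp add: m_assoc)
        also have "\<dots> = m \<otimes> r \<otimes> inv s" using ks mr by simp
        finally show ?thesis using c by (simp add: m_assoc)
      qed
      moreover have rs: "r \<otimes> inv s \<in> S"
        using ks mr S(1) by (simp add: subgroup.m_closed subgroup.m_inv_closed)
      moreover have "r \<otimes> inv s = inv m \<otimes> k" using calculation(1) c by simp
      then have "r \<otimes> inv s \<in> K"
        using ks mr MK D(1) by (auto intro: subgroup.m_closed subgroup.m_inv_closed)
      ultimately have "k \<in> L" using mr M_sub_L L(2) subgroup.m_closed[OF L(1)] by blast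
      then show False using L(3) by simp
    qed
    ultimately show ?thesis using M MK nM by blast
  qed
  then show ?case using separate_in_cyclic_ext[OF extension.hyps(2) _ _ _ _ _ _ S extension.prems(3)]
    by blast
qed

theorem polycyclic_imp_ERF:
  assumes "polycyclic G"
  shows "ERF G"
  unfolding ERF_iff
proof (intro allI impI ballI)
  fix S x assume S: "subgroup S G" and x: "x \<in> carrier G - S"
  have x': "x \<in> carrier G" "x \<notin> S" using x by auto
  have pc: "polycyclic_seq G (carrier G)" using assms by (simp add: polycyclic_def)
  obtain N and n :: nat where N: "subgroup N G" "S \<subseteq> N" "x \<notin> N" "n > 0" "\<And>h. h \<in> carrier G \<Longrightarrow> h [^] n \<in> N"
    using polycyclic_seq_separable[OF pc S subgroup.subset[OF S] x'] by blast
  have "finite_index N G"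
    using polycyclic_seq_finite_cosets[OF pc N(1,4,5)] finite_index_iff_finite_cosets[OF N(1)] by simp
  then show "\<exists>H. finite_index H G \<and> S \<subseteq> H \<and> x \<notin> H" using N by blast
qed

subsection \<open>Finite generation in ERF groups\<close>

lemma generate_finite_subset:
  assumes "x \<in> generate G A"
  shows "\<exists>B. finite B \<and> B \<subseteq> A \<and> x \<in> generate G B"
  using assms
proof (induction rule: generate.induct)
  case one
  then show ?case by (intro exI[of _ "{}"]) (simp add: generate.one)
next
  case (incl h)
  then show ?case by (intro exI[of _ "{h}"]) (simp add: generate.incl)
next
  case (inv h)
  then show ?case by (intro exI[of _ "{h}"]) (simp add: generate.inv)
next
  case (eng h1 h2)
  then obtain B C where BC: "finite B" "B \<subseteq> A" "h1 \<in> generate G B"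
    "finite C" "C \<subseteq> A" "h2 \<in> generate G C" by blast
  have "generate G B \<subseteq> generate G (B \<union> C)" "generate G C \<subseteq> generate G (B \<union> C)"
    by (simp_all add: mono_generate)
  then have "h1 \<otimes> h2 \<in> generate G (B \<union> C)" using BC by (blast intro: generate.eng)
  then show ?case using BC by (intro exI[of _ "B \<union> C"]) simp
qed

text \<open>Some positive power \<open>t\<^sup>n\<close> lies in any given subgroup of finite index, and conjugation by
  \<open>t\<^sup>n\<close> maps \<open>S\<close> into its conjugate by \<open>t\<close>. So a subgroup of finite index that contains this
  conjugate contains \<open>S\<close>.\<close>

lemma ERF_conj_invariant:
  assumes E: "ERF G" and S: "subgroup S G" and t: "t \<in> carrier G"
    and tS: "\<And>s. s \<in> S \<Longrightarrow> conjugate t s \<in> S" and x: "x \<in> S"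
  shows "conjugate (inv t) x \<in> S"
proof (rule ccontr)
  assume nx: "conjugate (inv t) x \<notin> S"
  \<comment> \<open>The conjugate of \<open>S\<close> by \<open>t\<close>, written as a preimage.
    The assumption says that \<open>x\<close> is outside it.\<close>
  define T where "T = {y \<in> carrier G. conjugate (inv t) y \<in> S}"
  have Sc: "S \<subseteq> carrier G" using subgroup.subset[OF S] .
  have xc: "x \<in> carrier G" using x Sc by auto
  have T: "subgroup T G"
  proof (rule subgroupI)
    show "T \<subseteq> carrier G" by (auto simp: T_def)
    have "\<one> \<in> T" using t subgroup.one_closed[OF S] by (simp add: T_def)
    then show "T \<noteq> {}" by blast
  qed (use t S in \<open>auto simp: T_def conjugate_mult conjugate_inv subgroup.m_closed subgroup.m_inv_closed\<close>)
  have "x \<in> carrier G - T" using nx xc by (simp add: T_def)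
  then obtain H where H: "finite_index H G" "T \<subseteq> H" "x \<notin> H"
    using E T unfolding ERF_iff by blast
  have sH: "subgroup H G" using H by (simp add: finite_index_def)
  obtain n :: nat where n: "n > 0" "\<And>y. y \<in> carrier G \<Longrightarrow> y [^] n \<in> H"
    using finite_index_powers_mem[OF H(1)] by blast
  then obtain m where m: "n = Suc m" using gr0_implies_Suc by blast
  \<comment> \<open>With \<open>n = Suc m\<close>, conjugating \<open>x\<close> by
    \<open>t [^] n\<close> lands in the conjugate \<open>T\<close> of \<open>S\<close>, hence in
    \<open>H\<close>. As \<open>t [^] n\<close> is in \<open>H\<close>, the conjugation can be
    undone there.\<close>
  have "conjugate (t [^] m) x \<in> S" by (rule conjugate_nat_pow_mem[OF Sc t tS x])
  moreover have "conjugate (inv t) (conjugate (t [^] n) x) = conjugate (t [^] m) x"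
  proof -
    have "inv t \<otimes> t [^] n = t [^] m" unfolding m using t nat_pow_Suc2[OF t, of m] by simp
    then show ?thesis using t xc by (simp add: conjugate_conjugate)
  qed
  ultimately have "conjugate (t [^] n) x \<in> T" using t xc by (simp add: T_def)
  then have y: "conjugate (t [^] n) x \<in> H" using H by blast
  have tn: "t [^] n \<in> H" using n t by blast
  have "inv (t [^] n) \<otimes> conjugate (t [^] n) x \<otimes> t [^] n \<in> H"
    using y tn sH by (simp add: subgroup.m_closed subgroup.m_inv_closed)
  then show False using H(3) t xc by (simp add: conjugate_def m_assoc)
qed

text \<open>The conjugates with nonnegative exponents generate a subgroup carried into itself by
  \<open>t\<close>, hence also by \<open>inv t\<close> by ERF. The element in question is then a
  word in finitely many of these conjugates.\<close>

lemma ERF_conj_backward: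
  assumes E: "ERF G" and a: "a \<in> carrier G" and t: "t \<in> carrier G"
  shows "\<exists>m::nat. conjugate (inv t) a \<in> generate G ((\<lambda>i::int. conjugate (t [^] i) a) ` {0..int m})"
proof -
  define c where "c i = conjugate (t [^] i) a" for i :: int
  have cc: "c ` I \<subseteq> carrier G" for I using a t by (auto simp: c_def)
  define S where "S = generate G (c ` {0..})"
  have S: "subgroup S G" unfolding S_def by (rule generate_is_subgroup[OF cc])
  have tS: "conjugate t s \<in> S" if s: "s \<in> S" for s
  proof (rule conjugate_generate_subset[OF cc S t _ s[unfolded S_def]])
    fix y assume "y \<in> c ` {0..}"
    then obtain i where i: "i \<ge> 0" "y = c i" by auto
    have "conjugate t y = c (1 + i)"
      using conjugate_int_pow[OF t a, of 1 i] i t by (simp add: c_def)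
    then show "conjugate t y \<in> S" using i by (auto simp: S_def intro: generate.incl)
  qed
  have "c 0 \<in> S" by (auto simp: S_def intro: generate.incl)
  then have "a \<in> S" using a by (simp add: c_def)
  then have "conjugate (inv t) a \<in> S" using ERF_conj_invariant[OF E S t tS] by blast
  then obtain B where B: "finite B" "B \<subseteq> c ` {0..}" "conjugate (inv t) a \<in> generate G B"
    using generate_finite_subset S_def by blast
  obtain C where C: "C \<subseteq> {0..}" "finite C" "B = c ` C" using finite_subset_image[OF B(1,2)] by blast
  \<comment> \<open>Inserting 0 keeps \<open>Max\<close> meaningful when \<open>C\<close> is
    empty.\<close>
  have "C \<subseteq> {0..int (nat (Max (insert 0 C)))}" using C by auto
  then have "B \<subseteq> c ` {0..int (nat (Max (insert 0 C)))}" using C by blast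
  then have "conjugate (inv t) a \<in> generate G (c ` {0..int (nat (Max (insert 0 C)))})"
    using mono_generate B(3) by blast
  then show ?thesis unfolding c_def by blast
qed

text \<open>\<open>ERF_conj_backward\<close> for \<open>t\<close> and for \<open>inv t\<close>
  expresses \<open>c (-1)\<close> through indices 0 to \<open>m\<close> and \<open>c 1\<close>
  through indices \<open>- n\<close> to 0. For the window from \<open>- n\<close> to
  \<open>m\<close>, conjugation by \<open>t\<close> or \<open>inv t\<close> leaves it only at an
  end, and there a shift of one of these two relations leads back.\<close>

lemma ERF_conj_finitely_generated:
  assumes E: "ERF G" and a: "a \<in> carrier G" and t: "t \<in> carrier G"
  shows "\<exists>F. finite F \<and> F \<subseteq> range (\<lambda>i::int. conjugate (t [^] i) a) \<and> a \<in> F \<and>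
    (\<forall>f\<in>F. conjugate t f \<in> generate G F \<and> conjugate (inv t) f \<in> generate G F)"
proof -
  define c where "c i = conjugate (t [^] i) a" for i :: int
  have cc: "c ` I \<subseteq> carrier G" for I using a t by (auto simp: c_def)
  have conj_c: "conjugate (t [^] j) (c i) = c (j + i)" for i j :: int
    using conjugate_int_pow[OF t a] by (simp add: c_def)
  have t1: "t = t [^] (1::int)" "inv t = t [^] (-1::int)" using t by (simp_all add: int_pow_neg)
  obtain m :: nat where "conjugate (inv t) a \<in> generate G (c ` {0..int m})"
    using ERF_conj_backward[OF E a t] c_def by auto
  then have m: "c (-1) \<in> generate G (c ` {0..int m})" using t1(2) by (simp add: c_def)
  obtain n :: nat where n: "conjugate (inv (inv t)) a \<in> generate G ((\<lambda>i::int. conjugate (inv t [^] i) a) ` {0..int n})"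
    using ERF_conj_backward[OF E a inv_closed[OF t]] by blast
  have "(\<lambda>i::int. conjugate (inv t [^] i) a) ` {0..int n} = c ` uminus ` {0..int n}"
    unfolding image_image c_def using t by (simp add: int_pow_inv int_pow_neg)
  then have n: "c 1 \<in> generate G (c ` {- int n..0})" using n t by (simp add: c_def)
  define F where "F = c ` {- int n..int m}"
  have genF: "subgroup (generate G F) G" unfolding F_def by (rule generate_is_subgroup[OF cc])
  have shift: "conjugate (t [^] j) x \<in> generate G F"
    if x: "x \<in> generate G (c ` {l..r})" and j: "j + l \<ge> - int n" "j + r \<le> int m" for j l r x
  proof (rule conjugate_generate_subset[OF cc genF _ _ x])
    fix y assume "y \<in> c ` {l..r}"
    then obtain i where i: "l \<le> i" "i \<le> r" "y = c i" by auto
    then have "c (j + i) \<in> F" using j by (auto simp: F_def)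
    then show "conjugate (t [^] j) y \<in> generate G F" using i conj_c by (simp add: generate.incl)
  qed (use t in simp)
  have "conjugate t f \<in> generate G F \<and> conjugate (inv t) f \<in> generate G F" if "f \<in> F" for f
  proof -
    obtain i where i: "- int n \<le> i" "i \<le> int m" "f = c i" using \<open>f \<in> F\<close> by (auto simp: F_def)
    have "conjugate t f = c (i + 1)" using conj_c[of 1 i] t1(1) i by (simp add: add.commute)
    moreover have "conjugate (inv t) f = c (i - 1)" using conj_c[of "-1" i] t1(2) i by simp
    moreover have "c (i + 1) \<in> generate G F"
    proof (cases "i = int m")
      case True
      have "conjugate (t [^] int m) (c 1) \<in> generate G F" by (rule shift[OF n]) auto
      then show ?thesis using conj_c True by simp
    next
      case False
      then have "c (i + 1) \<in> F" using i by (auto simp: F_def)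
      then show ?thesis by (rule generate.incl)
    qed
    moreover have "c (i - 1) \<in> generate G F"
    proof (cases "i = - int n")
      case True
      have "conjugate (t [^] (- int n)) (c (-1)) \<in> generate G F" by (rule shift[OF m]) auto
      then show ?thesis using conj_c True by simp
    next
      case False
      then have "c (i - 1) \<in> F" using i by (auto simp: F_def)
      then show ?thesis by (rule generate.incl)
    qed
    ultimately show ?thesis by simp
  qed
  moreover have "a \<in> F"
  proof -
    have "c 0 \<in> F" by (auto simp: F_def)
    then show ?thesis using a by (simp add: c_def)
  qed
  moreover have "finite F" "F \<subseteq> range (\<lambda>i::int. conjugate (t [^] i) a)"
    unfolding F_def c_def by auto
  ultimately show ?thesis by blast
qed

text \<open>The exponents form a subgroup of the integers, generated by \<open>d\<close>. The value
  \<open>d = 0\<close> covers the case of no nonzero exponent.\<close>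

lemma subgroup_power_exponents:
  assumes K: "subgroup K G" and t: "t \<in> carrier G"
  shows "\<exists>d::int. t [^] d \<in> K \<and> (\<forall>j::int. t [^] j \<in> K \<longrightarrow> d dvd j)"
proof (cases "\<exists>j::int. j \<noteq> 0 \<and> t [^] j \<in> K")
  case False
  then show ?thesis using subgroup.one_closed[OF K] by (intro exI[of _ 0]) auto
next
  case True
  then obtain j :: int where j: "j \<noteq> 0" "t [^] j \<in> K" by blast
  define P where "P p \<longleftrightarrow> p > 0 \<and> t [^] int p \<in> K" for p :: nat
  have "t [^] \<bar>j\<bar> \<in> K" using j subgroup.m_inv_closed[OF K] t by (simp add: abs_if int_pow_neg)
  then have "P (nat \<bar>j\<bar>)" using j by (simp add: P_def)
  then have d: "P (LEAST p. P p)" by (rule LeastI)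
  define d where "d = int (LEAST p. P p)"
  have d0: "d > 0" "t [^] d \<in> K" using d by (simp_all add: P_def d_def)
  have "d dvd i" if i: "t [^] i \<in> K" for i :: int
  proof -
    have "t [^] i \<otimes> inv ((t [^] d) [^] (i div d)) \<in> K"
      using i subgroup_int_pow_closed[OF K d0(2)] K by (simp add: subgroup.m_closed subgroup.m_inv_closed)
    also have "t [^] i \<otimes> inv ((t [^] d) [^] (i div d)) = t [^] (i mod d)"
      using t by (simp add: int_pow_pow int_pow_diff[symmetric] minus_mult_div_eq_mod)
    finally have r: "t [^] (i mod d) \<in> K" .
    have "\<not> P (nat (i mod d))"
      by (rule not_less_Least) (use d0 pos_mod_bound[of d i] pos_mod_sign[of d i] in \<open>simp add: d_def nat_less_iff\<close>)
    then have "i mod d = 0" using r pos_mod_sign[OF d0(1), of i] by (simp add: P_def)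
    then show ?thesis by (rule mod_0_imp_dvd)
  qed
  then show ?thesis using d0 by blast
qed

text \<open>Milnor's argument: \<open>H = \<langle>F\<rangle> \<langle>t\<rangle>\<close> for a finite subset \<open>F\<close> of \<open>K\<close> whose span is invariant under
  \<open>t\<close>, so that by Dedekind's law \<open>K\<close> is generated by \<open>F\<close> and a power of \<open>t\<close>.\<close>

lemma ERF_fin_gen_cyclic_ext:
  assumes E: "ERF G" and ext: "cyclic_ext K H t" and H: "fin_gen H"
  shows "fin_gen K"
proof -
  note D = cyclic_extD[OF ext]
  obtain X where X: "finite X" "X \<subseteq> carrier G" "generate G X = H" using H by (auto simp: fin_gen_def)
  have XH: "X \<subseteq> H" unfolding X(3)[symmetric] by (auto intro: generate.incl)
  have "\<forall>x\<in>X. \<exists>k. k \<in> K \<and> (\<exists>j::int. x = k \<otimes> t [^] j)"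
    using D(10)[OF subsetD[OF XH]] by blast
  then obtain k where k: "\<And>x. x \<in> X \<Longrightarrow> k x \<in> K" "\<And>x. x \<in> X \<Longrightarrow> \<exists>j::int. x = k x \<otimes> t [^] j" by metis
  define good where "good a F \<longleftrightarrow> finite F \<and> F \<subseteq> range (\<lambda>i::int. conjugate (t [^] i) a) \<and> a \<in> F \<and>
    (\<forall>f\<in>F. conjugate t f \<in> generate G F \<and> conjugate (inv t) f \<in> generate G F)" for a F
  have "\<exists>F. good a F" if "a \<in> carrier G" for a
    unfolding good_def by (rule ERF_conj_finitely_generated[OF E that D(5)])
  then have "\<forall>x\<in>X. \<exists>F. good (k x) F" using k(1) D(6) by blast
  then obtain F where F: "\<And>x. x \<in> X \<Longrightarrow> good (k x) (F x)" by metis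
  \<comment> \<open>The span \<open>A\<close> of \<open>U\<close> contains the \<open>K\<close>-part
    \<open>k x\<close> of every generator \<open>x\<close> and is invariant under \<open>t\<close>
    and \<open>inv t\<close>. So \<open>A <#> P\<close> is a subgroup containing \<open>X\<close>,
    and hence \<open>H\<close>.\<close>
  define U where "U = (\<Union>x\<in>X. F x)"
  have U: "finite U" using X F by (auto simp: U_def good_def)
  have UK: "U \<subseteq> K"
  proof
    fix u assume "u \<in> U"
    then obtain x i where "x \<in> X" "u = conjugate (t [^] (i::int)) (k x)"
      using F unfolding U_def good_def by blast
    then show "u \<in> K" using D(8)[OF D(9) k(1)] by simp
  qed
  have Uc: "U \<subseteq> carrier G" using UK D(6) by blast
  define A where "A = generate G U"
  have A: "subgroup A G" unfolding A_def by (rule generate_is_subgroup[OF Uc])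
  have AK: "A \<subseteq> K" unfolding A_def by (rule generate_subgroup_incl[OF UK D(1)])
  have Ac: "A \<subseteq> carrier G" using AK D(6) by blast
  have tU: "conjugate t u \<in> A \<and> conjugate (inv t) u \<in> A" if u: "u \<in> U" for u
  proof -
    obtain x where x: "x \<in> X" "u \<in> F x" using u by (auto simp: U_def)
    have "generate G (F x) \<subseteq> A" unfolding A_def using x by (intro mono_generate) (auto simp: U_def)
    then show ?thesis using F[OF x(1)] x(2) unfolding good_def by blast
  qed
  define P where "P = range (\<lambda>i::int. t [^] i)"
  have nA: "normalizes P A"
    unfolding P_def
  proof (rule normalizes_powers[OF Ac D(5)])
    show "conjugate t a \<in> A" if "a \<in> A" for a
      by (rule conjugate_generate_subset[OF Uc A D(5) _ that[unfolded A_def]]) (use tU in blast)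
    show "conjugate (inv t) a \<in> A" if "a \<in> A" for a
      by (rule conjugate_generate_subset[OF Uc A inv_closed[OF D(5)] _ that[unfolded A_def]]) (use tU in blast)
  qed
  have P: "subgroup P G" unfolding P_def by (rule subgroup_powers[OF D(5)])
  have AP: "subgroup (A <#> P) G" by (rule subgroup_set_mult[OF A P nA])
  have "X \<subseteq> A <#> P"
  proof
    fix x assume x: "x \<in> X"
    have "k x \<in> A" unfolding A_def U_def using F[OF x] x by (auto simp: good_def intro: generate.incl)
    then show "x \<in> A <#> P" using k(2)[OF x] by (force simp: P_def set_mult_def)
  qed
  then have HAP: "H \<subseteq> A <#> P" unfolding X(3)[symmetric] by (rule generate_subgroup_incl[OF _ AP])
  obtain d :: int where d: "t [^] d \<in> K" "\<And>j::int. t [^] j \<in> K \<Longrightarrow> d dvd j"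
    using subgroup_power_exponents[OF D(1,5)] by blast
  let ?V = "insert (t [^] d) U"
  have VK: "?V \<subseteq> K" using d(1) UK by blast
  have Vc: "?V \<subseteq> carrier G" using VK D(6) by blast
  have V: "subgroup (generate G ?V) G" by (rule generate_is_subgroup[OF Vc])
  have "y \<in> generate G ?V" if y: "y \<in> K" for y
  proof -
    \<comment> \<open>As \<open>A\<close> lies in \<open>K\<close>, the power of \<open>t\<close>
      occurring in \<open>y\<close> lies in \<open>K\<close> too and is a power of
      \<open>t [^] d\<close>.\<close>
    have "y \<in> A <#> P" using y D(3) HAP by blast
    then obtain a and j :: int where a: "a \<in> A" "y = a \<otimes> t [^] j" by (auto simp: set_mult_def P_def)
    have "a \<in> carrier G" using a Ac by blast
    then have "t [^] j = inv a \<otimes> y" using a D(5) by simp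
    moreover have "inv a \<otimes> y \<in> K"
      using a AK y D(1) by (auto intro: subgroup.m_closed subgroup.m_inv_closed)
    ultimately have "d dvd j" using d(2) by simp
    then obtain q where "j = d * q" by (elim dvdE)
    then have "t [^] j = (t [^] d) [^] q" using D(5) by (simp add: int_pow_pow)
    moreover have "t [^] d \<in> generate G ?V" by (rule generate.incl) simp
    ultimately have "t [^] j \<in> generate G ?V" using subgroup_int_pow_closed[OF V] by simp
    moreover have "a \<in> generate G ?V" using a(1) mono_generate[of U ?V] unfolding A_def by blast
    ultimately show ?thesis using a(2) by (simp add: generate.eng)
  qed
  then have "generate G ?V = K" using generate_subgroup_incl[OF VK D(1)] by blast
  then show ?thesis using U Vc unfolding fin_gen_def by blast
qed

text \<open>Adjoining the elements of \<open>A\<close> one by one gives cyclic extensions. Finite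
  generation descends through them to \<open>K\<close>, where \<open>IH\<close> applies, and
  polycyclicity climbs back up; hence \<open>fg\<close> takes part in the induction.\<close>

lemma ERF_polycyclic_seq_abelian_ext:
  assumes E: "ERF G" and K: "subgroup K G" and H: "subgroup H G" and KH: "K \<subseteq> H"
    and comm: "\<And>x y. \<lbrakk>x \<in> H; y \<in> H\<rbrakk> \<Longrightarrow> conjugate x y \<otimes> inv y \<in> K"
    and IH: "fin_gen K \<Longrightarrow> polycyclic_seq G K"
    and A: "finite A" "A \<subseteq> H" and fg: "fin_gen (generate G (K \<union> A))"
  shows "polycyclic_seq G (generate G (K \<union> A))"
  using A fg
proof (induction A rule: finite_induct)
  case empty
  have "generate G K = K" using generate_subgroup_incl[OF order_refl K] by (auto intro: generate.incl)
  then show ?case using IH empty.prems by simp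
next
  case (insert a A)
  let ?L = "generate G (K \<union> A)" and ?M = "generate G (K \<union> insert a A)"
  have Hc: "H \<subseteq> carrier G" using subgroup.subset[OF H] .
  have sub: "K \<union> A \<subseteq> H" "K \<union> insert a A \<subseteq> H" using KH insert.prems by auto
  have L: "subgroup ?L G" "?L \<subseteq> H" and M: "subgroup ?M G" "?M \<subseteq> H"
    using generate_is_subgroup[OF subset_trans[OF sub(1) Hc]] generate_subgroup_incl[OF sub(1) H]
      generate_is_subgroup[OF subset_trans[OF sub(2) Hc]] generate_subgroup_incl[OF sub(2) H] .
  have a: "a \<in> ?M" "a \<in> carrier G" "a \<in> H" using insert.prems Hc by (auto intro: generate.incl)
  \<comment> \<open>A subgroup between \<open>K\<close> and \<open>H\<close> contains the
    commutators of \<open>H\<close>, so it is normal in \<open>H\<close>.\<close>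
  have nHL: "conjugate h l \<in> ?L" if "h \<in> H" "l \<in> ?L" for h l
  proof -
    have c: "h \<in> carrier G" "l \<in> carrier G" using that L Hc by auto
    have "conjugate h l \<otimes> inv l \<in> ?L" using comm that L by (blast intro: generate.incl)
    then have "conjugate h l \<otimes> inv l \<otimes> l \<in> ?L" using that by (simp add: generate.eng)
    then show ?thesis using c by (simp add: m_assoc)
  qed
  let ?P = "range (\<lambda>i::int. a [^] i)"
  have P: "subgroup ?P G" by (rule subgroup_powers[OF a(2)])
  have "normalizes ?P ?L" using nHL subgroup_int_pow_closed[OF H a(3)] by (auto simp: normalizes_def)
  then have LP: "subgroup (?L <#> ?P) G" by (rule subgroup_set_mult[OF L(1) P])
  have "K \<union> A \<subseteq> ?L <#> ?P" using subset_set_mult(1)[OF L(1) P] by (blast intro: generate.incl)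
  moreover have "a \<in> ?L <#> ?P"
  proof -
    have "a [^] (1::int) \<in> ?P" by blast
    then show ?thesis using a(2) subset_set_mult(2)[OF L(1) P] by auto
  qed
  ultimately have "?M \<subseteq> ?L <#> ?P" by (intro generate_subgroup_incl[OF _ LP]) auto
  then have "\<forall>h\<in>?M. \<exists>k\<in>?L. \<exists>j::int. h = k \<otimes> a [^] j" by (force simp: set_mult_def)
  moreover have "?L \<subseteq> ?M" by (rule mono_generate) auto
  moreover have "normalizes ?M ?L" using nHL M(2) by (auto simp: normalizes_def)
  ultimately have ext: "cyclic_ext ?L ?M a" using L(1) M(1) a(1) by (simp add: cyclic_ext_def)
  have "fin_gen ?L" by (rule ERF_fin_gen_cyclic_ext[OF E ext insert.prems(2)])
  then have "polycyclic_seq G ?L" using insert by simp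
  then show ?case by (rule polycyclic_seq_cyclic_ext[OF _ ext])
qed

text \<open>Finite generation is a premise inside the induction, since at first it is known only for
  the top term and has to be handed down the series.\<close>

lemma ERF_solvable_seq_imp_polycyclic_seq:
  assumes "ERF G" "solvable_seq G H" "fin_gen H"
  shows "polycyclic_seq G H"
  using assms(2,3)
proof (induction rule: solvable_seq.induct)
  case unity
  show ?case by (rule polycyclic_seq.unity)
next
  case (extension K H)
  have K: "subgroup K G" using solvable_imp_subgroup extension.hyps(1) by blast
  have H: "subgroup H G" by fact
  have KH: "K \<subseteq> H" using subgroup.subset[OF normal_imp_subgroup[OF extension.hyps(2)]] by simp
  have "derived G H \<subseteq> K" using derived_of_subgroup_minimal[OF extension.hyps(2-4)] .
  then have comm: "conjugate x y \<otimes> inv y \<in> K" if "x \<in> H" "y \<in> H" for x y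
    using that unfolding derived_def conjugate_def by (blast intro: generate.incl)
  obtain X where X: "finite X" "generate G X = H" using extension.prems by (auto simp: fin_gen_def)
  have XH: "X \<subseteq> H" unfolding X(2)[symmetric] by (auto intro: generate.incl)
  \<comment> \<open>Presents \<open>H\<close> as \<open>K\<close> with finitely many elements
    adjoined.\<close>
  have eq: "generate G (K \<union> X) = H"
    using X(2) mono_generate[of X "K \<union> X"] generate_subgroup_incl[OF _ H, of "K \<union> X"] KH XH by blast
  show ?case
    using ERF_polycyclic_seq_abelian_ext[OF assms(1) K H KH comm extension.IH X(1) XH] extension.prems
    unfolding eq by blast
qed

end

theorem theorem3:
  fixes G :: "('a, 'b) monoid_scheme" (structure)
  assumes "group G" and "finitely_generated_group G" and "solvable G"
  shows "ERF G \<longleftrightarrow> polycyclic G"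
proof -
  interpret group G by (rule assms(1))
  have "fin_gen (carrier G)" "solvable_seq G (carrier G)"
    using assms(2,3) by (auto simp: fin_gen_def finitely_generated_group_def solvable_def)
  then show ?thesis
    using ERF_solvable_seq_imp_polycyclic_seq polycyclic_imp_ERF by (auto simp: polycyclic_def)
qed

end
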